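(* Let $q$ be a complex number with $|q|<1$. Then the following four identities hold: \begin{align*} \sum_{i,j,k\ge 0}\frac{q^{i^2+2j^2+3k^2+2ij+2ik+4jk}}{(q^2;q^2)_i(q^2;q^2)_j(q^4;q^4)_k} &=\frac{(q^4,q^5,q^9;q^9)_\infty}{(q;q^2)_\infty(q^4;q^4)_\infty},\\ \sum_{i,j,k\ge 0}\frac{q^{i^2+2j^2+3k^2+2ij+2ik+4jk+2k}}{(q^2;q^2)_i(q^2;q^2)_j(q^4;q^4)_k} &=\frac{(q^3;q^3)_\infty}{(q;q^2)_\infty(q^4;q^4)_\infty},\\ \sum_{i,j,k\ge 0}\frac{q^{i^2+2j^2+3k^2+2ij+2ik+4jk+2j+2k}}{(q^2;q^2)_i(q^2;q^2)_j(q^4;q^4)_k} &=\frac{(q^2,q^7,q^9;q^9)_\infty}{(q;q^2)_\infty(q^4;q^4)_\infty},\\ \sum_{i,j,k\ge 0}\frac{q^{i^2+2j^2+3k^2+2ij+2ik+4jk+2i+2j+4k}}{(q^2;q^2)_i(q^2;q^2)_j(q^4;q^4)_k} &=\frac{(q,q^8,q^9;q^9)_\infty}{(q;q^2)_\infty(q^4;q^4)_\infty}. \end{align*}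
   Context: For $|q|<1$: $(a;q)_\infty=\prod_{m=0}^\infty(1-aq^m)$, $(a;q)_n=(a;q)_\infty/(aq^n;q)_\infty=\prod_{m=0}^{n-1}(1-aq^m)$ for integers $n\ge0$, and $(a_1,\dots,a_r;q)_\infty=(a_1;q)_\infty\cdots(a_r;q)_\infty$; the same notation is used with the base $q$ replaced by a power of $q$. *)

theory Defs
  imports "HOL-Analysis.Analysis"
begin

definition qpoch :: "complex \<Rightarrow> complex \<Rightarrow> nat \<Rightarrow> complex" where
  "qpoch a q n = (\<Prod>m<n. 1 - a * q ^ m)"

definition qpoch_inf :: "complex \<Rightarrow> complex \<Rightarrow> complex" where
  "qpoch_inf a q = (\<Prod>m. 1 - a * q ^ m)"

definition qpoch_inf_list :: "complex list \<Rightarrow> complex \<Rightarrow> complex" where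
  "qpoch_inf_list as q = (\<Prod>a\<leftarrow>as. qpoch_inf a q)"

(* The infinite product converges for every a, vanishing factors included, so qpoch_inf is
   never an unspecified value in the range norm q < 1. *)
lemma qpoch_inf_has_prod:
  assumes "norm q < 1"
  shows "(\<lambda>m. 1 - a * q ^ m) has_prod qpoch_inf a q"
proof -
  have "summable (\<lambda>m. norm a * norm q ^ m)"
    using assms by (intro summable_mult summable_geometric) simp
  then have "abs_convergent_prod (\<lambda>m. 1 + - (a * q ^ m))"
    by (intro summable_imp_abs_convergent_prod) (simp add: norm_mult norm_power)
  then have "convergent_prod (\<lambda>m. 1 - a * q ^ m)"
    using abs_convergent_prod_imp_convergent_prod by fastforce
  then show ?thesis
    unfolding qpoch_inf_def by (rule convergent_prod_has_prod)
qed

(* For norm q < 1, (a;q)_n = (a;q)_inf / (a q^n;q)_inf whenever the quotient is defined. *)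
lemma qpoch_inf_split:
  assumes "norm q < 1"
  shows "qpoch_inf a q = qpoch a q n * qpoch_inf (a * q ^ n) q"
proof -
  have lim: "(\<lambda>N. \<Prod>m<N. 1 - b * q ^ m) \<longlonglongrightarrow> qpoch_inf b q" for b
    using has_prod_imp_tendsto[OF qpoch_inf_has_prod[OF assms, of b]]
    by (simp add: LIMSEQ_lessThan_iff_atMost[where f = "prod _"])
  have split: "(\<Prod>m<N + n. 1 - a * q ^ m) = qpoch a q n * (\<Prod>m<N. 1 - (a * q ^ n) * q ^ m)" for N
    by (induction N) (simp_all add: qpoch_def power_add mult_ac)
  have "(\<lambda>N. \<Prod>m<N + n. 1 - a * q ^ m) \<longlonglongrightarrow> qpoch a q n * qpoch_inf (a * q ^ n) q"
    unfolding split by (intro tendsto_mult tendsto_const lim)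
  moreover have "(\<lambda>N. \<Prod>m<N + n. 1 - a * q ^ m) \<longlonglongrightarrow> qpoch_inf a q"
    using lim[of a] by (rule LIMSEQ_ignore_initial_segment)
  ultimately show ?thesis
    using LIMSEQ_unique by blast
qed

end

theory Submission
  imports Defs
begin

text \<open>
  Write \<open>Q = q\<^sup>2\<close>.  In each triple sum put \<open>n = j + k\<close>.  Euler's series
  \<open>\<Sum>i. (-y)^i Q^(i choose 2) / (Q;Q)_i = (y;Q)_inf\<close> performs the sum over \<open>i\<close> and leaves
  \<open>\<Sum>n. a^n Q^(n\<^sup>2) (x Q^n;Q)_inf (\<Sum>k\<le>n. w_k \<beta>_k / (Q;Q)_(n-k))\<close>, where \<open>a\<close> is \<open>1\<close> or \<open>Q\<close>,
  \<open>-x\<close> is an odd power of \<open>q\<close>, and \<open>w_k\<close> is the weight that Bailey's lemma attaches to the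
  parameter \<open>x\<close>.  If \<open>\<beta>\<close> belongs to a Bailey pair \<open>(\<alpha>, \<beta>)\<close> relative to \<open>a\<close>, the lemma applies
  twice: once with one finite parameter, for the inner sum (\<open>bailey_lemma\<close>), and once in its
  limiting form, for the sum over \<open>n\<close> (\<open>durfee_sum\<close>).  The result, \<open>bailey_triple_sum\<close>, is a
  single series in \<open>\<alpha>\<close>.

  The four sums need \<open>\<beta>_k = q^(t k) / ((-q^v;Q)_k (q^4;q^4)_k)\<close> with \<open>v \<in> {1, 3}\<close> and \<open>t \<in> {0,
  2}\<close>. These belong to Bailey pairs of Slater, whose \<open>\<alpha>_r\<close> is, up to a constant, \<open>(-1)^r\<close> times a
  sum or difference of two powers of \<open>q\<close> with exponents \<open>3 r\<^sup>2 / 2 + \<dots>\<close>. The two applications of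
  Bailey's lemma add \<open>r\<^sup>2\<close> and \<open>2 r\<^sup>2\<close> to the exponent, so that theta series with exponents \<open>9 r\<^sup>2
  / 2 + \<dots>\<close> appear, and the Jacobi triple product with base \<open>q^9\<close> evaluates them.

  The sums over \<open>i\<close>, \<open>k\<close> and \<open>n\<close> all rest on one finite identity, the q-Chu-Vandermonde sum
  \<open>q_chu_vandermonde\<close>, written without division by its parameters so that \<open>y = 0\<close> and
  \<open>c = 0\<close> are permitted: it gives Bailey's lemma, and its limit gives Euler's series (\<open>c = 0\<close>) and the
  Durfee-square sum (\<open>y = 0\<close>).  Slater's pairs and a finite form of the Jacobi triple product are
  both proved by passing back and forth between sums with denominators \<open>(Q)_(n-r) (Q)_(n+r)\<close> and
  \<open>(Q)_(n-r) (Q)_(n+r+1)\<close>; such a step only uses \<open>(Q)_(m+1) = (Q)_m (1 - Q^(m+1))\<close>.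
\<close>

section \<open>Finite and infinite q-shifted factorials\<close>

lemma qpoch_0 [simp]: "qpoch a q 0 = 1"
  by (simp add: qpoch_def)

lemma qpoch_Suc: "qpoch a q (Suc n) = qpoch a q n * (1 - a * q ^ n)"
  by (simp add: qpoch_def)

lemma qpoch_add: "qpoch a q (m + n) = qpoch a q m * qpoch (a * q ^ m) q n"
  by (induction n) (simp_all add: qpoch_Suc power_add mult_ac)

lemma qpoch_Suc_left: "qpoch a q (Suc n) = (1 - a) * qpoch (a * q) q n"
  using qpoch_add[of a q 1 n] by (simp add: qpoch_Suc)

lemma norm_mult_power_less_1:
  fixes a q :: complex
  assumes "norm a < 1" "norm q < 1"
  shows "norm (a * q ^ m) < 1"
proof -
  have "norm (a * q ^ m) \<le> norm a * 1"
    unfolding norm_mult norm_power using assms by (intro mult_left_mono power_le_one) auto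
  then show ?thesis using assms by linarith
qed

lemma mult_power_neq_1:
  fixes a q :: complex
  assumes "norm a < 1" "norm q < 1"
  shows "a * q ^ m \<noteq> 1"
  using norm_mult_power_less_1[OF assms, of m] by auto

lemma qpoch_nonzero:
  assumes "norm a < 1" "norm q < 1"
  shows "qpoch a q n \<noteq> 0"
  using mult_power_neq_1[OF assms] by (auto simp: qpoch_def)

lemma qpoch_inf_nonzero:
  assumes "norm a < 1" "norm q < 1"
  shows "qpoch_inf a q \<noteq> 0"
  using qpoch_inf_has_prod[OF assms(2), of a] mult_power_neq_1[OF assms]
  by (auto simp: has_prod_eq_0_iff)

lemma qpoch_tendsto:
  assumes "norm q < 1"
  shows "qpoch a q \<longlonglongrightarrow> qpoch_inf a q"
proof -
  have "(\<lambda>n. qpoch a q (Suc n)) \<longlonglongrightarrow> qpoch_inf a q"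
    using has_prod_imp_tendsto[OF qpoch_inf_has_prod[OF assms, of a]]
    by (simp add: qpoch_def lessThan_Suc_atMost)
  then show ?thesis by (rule LIMSEQ_imp_Suc)
qed

lemma inverse_qpoch_bounded:
  assumes "norm a < 1" "norm q < 1"
  obtains B where "B > 0" "\<And>n. norm (1 / qpoch a q n) \<le> B"
proof -
  have "(\<lambda>n. 1 / qpoch a q n) \<longlonglongrightarrow> 1 / qpoch_inf a q"
    using assms by (intro tendsto_intros qpoch_tendsto qpoch_inf_nonzero)
  then have "Bseq (\<lambda>n. 1 / qpoch a q n)"
    by (intro convergent_imp_Bseq) (auto simp: convergent_def)
  then show ?thesis using that by (auto simp: Bseq_def)
qed

lemma choose_two_0 [simp]: "0 choose 2 = 0"
  by (simp add: binomial_eq_0)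

lemma choose_two_Suc: "Suc n choose 2 = (n choose 2) + n"
  by (simp add: numeral_2_eq_2)

lemma square_eq_choose_two: "n\<^sup>2 = 2 * (n choose 2) + n"
  by (induction n) (simp_all add: choose_two_Suc power2_eq_square)

lemma one_minus_power_nonzero:
  fixes q :: complex
  assumes "norm q < 1" "n > 0"
  shows "1 - q ^ n \<noteq> 0"
  using assms norm_power[of q n] power_less_one_iff[of "norm q" n] by (metis eq_iff_diff_eq_0 less_irrefl norm_ge_zero norm_one)

lemma norm_power_le_1: "norm (z::complex) < 1 \<Longrightarrow> norm (z ^ k) \<le> 1"
  unfolding norm_power by (intro power_le_one) auto

text \<open>
  The factors \<open>1 - a q^m\<close> are sorted by the residue of \<open>m\<close> modulo \<open>k\<close>.
\<close>

lemma qpoch_multisection: "qpoch a q (k * n) = (\<Prod>j<k. qpoch (a * q ^ j) (q ^ k) n)"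
proof (induction n)
  case (Suc n)
  have "qpoch a q (k * Suc n) = qpoch a q (k * n) * qpoch (a * q ^ (k * n)) q k"
    by (simp add: qpoch_add[symmetric] add.commute)
  also have "qpoch (a * q ^ (k * n)) q k = (\<Prod>j<k. 1 - a * q ^ j * (q ^ k) ^ n)"
    by (simp add: qpoch_def power_mult mult_ac)
  finally show ?case
    by (simp add: Suc qpoch_Suc prod.distrib)
qed simp

lemma qpoch_inf_multisection:
  assumes "norm q < 1" "k > 0"
  shows "qpoch_inf a q = (\<Prod>j<k. qpoch_inf (a * q ^ j) (q ^ k))"
proof -
  have "norm (q ^ k) < 1"
    using assms by (simp add: norm_power power_less_one_iff)
  then have "(\<lambda>n. \<Prod>j<k. qpoch (a * q ^ j) (q ^ k) n) \<longlonglongrightarrow> (\<Prod>j<k. qpoch_inf (a * q ^ j) (q ^ k))"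
    by (intro tendsto_prod qpoch_tendsto)
  moreover have "(\<lambda>n. qpoch a q (k * n)) \<longlonglongrightarrow> qpoch_inf a q"
    using LIMSEQ_subseq_LIMSEQ[OF qpoch_tendsto[OF assms(1), of a], of "\<lambda>n. k * n"] assms(2)
    by (simp add: strict_mono_def o_def)
  ultimately show ?thesis
    unfolding qpoch_multisection using LIMSEQ_unique by blast
qed

lemma qpoch_inf_mult_neg:
  assumes "norm q < 1"
  shows "qpoch_inf (- a) q * qpoch_inf a q = qpoch_inf (a\<^sup>2) (q\<^sup>2)"
proof -
  have "qpoch (- a) q n * qpoch a q n = qpoch (a\<^sup>2) (q\<^sup>2) n" for n
    by (simp add: qpoch_def prod.distrib[symmetric] power2_eq_square algebra_simps power_mult_distrib)
  moreover have "(\<lambda>n. qpoch (- a) q n * qpoch a q n) \<longlonglongrightarrow> qpoch_inf (- a) q * qpoch_inf a q"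
    by (intro tendsto_intros qpoch_tendsto assms)
  moreover have "qpoch (a\<^sup>2) (q\<^sup>2) \<longlonglongrightarrow> qpoch_inf (a\<^sup>2) (q\<^sup>2)"
    using assms by (intro qpoch_tendsto) (simp add: norm_power power_less_one_iff)
  ultimately show ?thesis
    using LIMSEQ_unique by fastforce
qed

section \<open>The q-Chu-Vandermonde sum and its limit\<close>

text \<open>
  The term of the q-Chu-Vandermonde sum with parameters \<open>b\<close> and \<open>c\<close>, where \<open>y = c / b\<close>: the product
  \<open>(b;q)_m y^m\<close> is written as \<open>\<Prod>i<m. y - c q^i\<close>, a polynomial in \<open>y\<close> and \<open>c\<close>.  The limits
  \<open>b \<rightarrow> \<infinity>\<close> (\<open>y = 0\<close>) and \<open>b, c \<rightarrow> 0\<close> (\<open>c = 0\<close>, \<open>y\<close> fixed) thus become substitutions.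
\<close>

definition qcv_term :: "complex \<Rightarrow> complex \<Rightarrow> complex \<Rightarrow> nat \<Rightarrow> complex" where
  "qcv_term q y c m =
     (-1) ^ m * q ^ (m choose 2) * (\<Prod>i<m. y - c * q ^ i) / (qpoch q q m * qpoch c q m)"

lemma qcv_term_0 [simp]: "qcv_term q y c 0 = 1"
  by (simp add: qcv_term_def binomial_eq_0)

lemma qcv_term_Suc:
  "qcv_term q y c (Suc m) =
     qcv_term q y c m * (- (q ^ m) * (y - c * q ^ m) / ((1 - q ^ Suc m) * (1 - c * q ^ m)))"
  by (simp add: qcv_term_def qpoch_Suc choose_two_Suc power_add mult_ac)

lemma qcv_term_Suc_left:
  assumes "norm q < 1"
  shows "qcv_term q y c (Suc m) * (1 - q ^ Suc m) =
     - (q ^ m) * ((y - c) / (1 - c)) * qcv_term q y (c * q) m"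
proof -
  have "(\<Prod>i<Suc m. y - c * q ^ i) = (y - c) * (\<Prod>i<m. y - c * q * q ^ i)"
    by (simp add: prod.lessThan_Suc_shift mult_ac del: prod.lessThan_Suc)
  then have "qcv_term q y c (Suc m) = (-1) ^ Suc m * q ^ (m choose 2) * q ^ m *
      ((y - c) * (\<Prod>i<m. y - c * q * q ^ i))
      / (qpoch q q m * (1 - q ^ Suc m) * ((1 - c) * qpoch (c * q) q m))"
    unfolding qcv_term_def qpoch_Suc_left[of c] choose_two_Suc
    by (simp add: qpoch_Suc power_add del: prod.lessThan_Suc)
  then have "qcv_term q y c (Suc m) * (1 - q ^ Suc m) = (-1) ^ Suc m * q ^ (m choose 2) * q ^ m *
      ((y - c) * (\<Prod>i<m. y - c * q * q ^ i)) / (qpoch q q m * ((1 - c) * qpoch (c * q) q m))"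
    using one_minus_power_nonzero[OF assms, of "Suc m"] by (simp del: power_Suc)
  then show ?thesis
    by (simp add: qcv_term_def mult_ac)
qed

text \<open>
  Induction on \<open>N\<close> for all \<open>c\<close> at once.  Splitting
  \<open>1 - q^(N+1) = (1 - q^(N+1-m)) + q^(N+1-m) (1 - q^m)\<close> cancels one factor of \<open>(q)_(N+1-m)\<close> in the
  first part and one of \<open>(q)_m\<close> in the second, which gives the sums for \<open>(N, c)\<close> and \<open>(N, c q)\<close>.
\<close>

lemma q_chu_vandermonde:
  assumes "norm q < 1" "\<And>m. c * q ^ m \<noteq> 1"
  shows "(\<Sum>m\<le>N. qcv_term q y c m / qpoch q q (N - m)) = qpoch y q N / (qpoch q q N * qpoch c q N)"
  using assms(2)
proof (induction N arbitrary: c)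
  case (Suc N)
  let ?T = "qcv_term q y c" and ?P = "qpoch q q"
  have PSuc: "?P (Suc n) = ?P n * (1 - q ^ Suc n)" for n
    by (simp add: qpoch_Suc)
  have nz: "1 - q ^ Suc n \<noteq> 0" for n
    by (rule one_minus_power_nonzero[OF assms(1)]) simp
  have c: "1 - c \<noteq> 0" using Suc.prems[of 0] by simp
  have IH1: "(\<Sum>m\<le>N. ?T m / ?P (N - m)) = qpoch y q N / (?P N * qpoch c q N)"
    using Suc.prems by (rule Suc.IH)
  have IH2: "(\<Sum>m\<le>N. qcv_term q y (c * q) m / ?P (N - m))
               = qpoch y q N / (?P N * qpoch (c * q) q N)"
    using Suc.prems[of "Suc _"] by (intro Suc.IH) (simp add: mult.assoc)
  have split: "(1 - q ^ Suc N) * (?T m / ?P (Suc N - m))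
      = ?T m * (1 - q ^ (Suc N - m)) / ?P (Suc N - m)
        + q ^ (Suc N - m) * (?T m * (1 - q ^ m)) / ?P (Suc N - m)" if "m \<le> Suc N" for m
  proof -
    have "q ^ Suc N = q ^ (Suc N - m) * q ^ m"
      using that by (simp add: power_add[symmetric])
    then show ?thesis
      by (simp only: add_divide_distrib[symmetric]) (simp add: algebra_simps)
  qed
  have first: "(\<Sum>m\<le>Suc N. ?T m * (1 - q ^ (Suc N - m)) / ?P (Suc N - m))
                 = (\<Sum>m\<le>N. ?T m / ?P (N - m))"
  proof -
    have "?T m * (1 - q ^ (Suc N - m)) / ?P (Suc N - m) = ?T m / ?P (N - m)" if "m \<le> N" for m
      using that nz[of "N - m"] by (simp add: Suc_diff_le PSuc del: power_Suc)
    then show ?thesis by simp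
  qed
  have second: "(\<Sum>m\<le>Suc N. q ^ (Suc N - m) * (?T m * (1 - q ^ m)) / ?P (Suc N - m))
                 = - (q ^ N) * ((y - c) / (1 - c)) * (\<Sum>m\<le>N. qcv_term q y (c * q) m / ?P (N - m))"
  proof -
    have "q ^ (N - m) * (?T (Suc m) * (1 - q ^ Suc m)) / ?P (N - m)
        = - (q ^ N) * ((y - c) / (1 - c)) * (qcv_term q y (c * q) m / ?P (N - m))" if "m \<le> N" for m
    proof -
      have "q ^ N = q ^ (N - m) * q ^ m"
        using that by (simp add: power_add[symmetric])
      then show ?thesis
        unfolding qcv_term_Suc_left[OF assms(1)] by simp
    qed
    then show ?thesis
      unfolding sum.atMost_Suc_shift sum_distrib_left by (simp del: power_Suc)
  qed
  have "(1 - q ^ Suc N) * (\<Sum>m\<le>Suc N. ?T m / ?P (Suc N - m))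
      = qpoch y q N / (?P N * qpoch c q N)
        - q ^ N * ((y - c) / (1 - c)) * (qpoch y q N / (?P N * qpoch (c * q) q N))"
    unfolding sum_distrib_left
    by (subst sum.cong[OF refl split], simp) (simp add: sum.distrib first second IH1 IH2 del: sum.atMost_Suc power_Suc)
  also have "qpoch y q N / (?P N * qpoch c q N)
               = qpoch y q N * (1 - c * q ^ N) / (?P N * qpoch c q (Suc N))"
    using Suc.prems[of N] by (simp add: qpoch_Suc)
  also have "\<dots> - q ^ N * ((y - c) / (1 - c)) * (qpoch y q N / (?P N * qpoch (c * q) q N))
     = qpoch y q N * (1 - c * q ^ N - q ^ N * (y - c)) / (?P N * qpoch c q (Suc N))"
  proof -
    have "q ^ N * ((y - c) / (1 - c)) * (qpoch y q N / (?P N * qpoch (c * q) q N))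
        = qpoch y q N * (q ^ N * (y - c)) / (?P N * qpoch c q (Suc N))"
      by (simp add: qpoch_Suc_left mult_ac)
    then show ?thesis
      by (simp only: diff_divide_distrib[symmetric] right_diff_distrib[symmetric])
  qed
  also have "1 - c * q ^ N - q ^ N * (y - c) = 1 - y * q ^ N"
    by (simp add: algebra_simps)
  finally have "(1 - q ^ Suc N) * (\<Sum>m\<le>Suc N. ?T m / ?P (Suc N - m))
      = qpoch y q (Suc N) / (?P N * qpoch c q (Suc N))"
    by (simp add: qpoch_Suc)
  then have "(\<Sum>m\<le>Suc N. ?T m / ?P (Suc N - m))
      = qpoch y q (Suc N) / (?P N * qpoch c q (Suc N)) / (1 - q ^ Suc N)"
    using nz[of N] by (metis nonzero_mult_div_cancel_left)
  then show ?case
    by (simp add: PSuc mult_ac)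
qed simp

text \<open>
  Tannery's theorem for finite sums whose range grows with the parameter.
\<close>

lemma tendsto_weighted_sum:
  fixes f :: "nat \<Rightarrow> complex" and w :: "nat \<Rightarrow> nat \<Rightarrow> complex"
  assumes "summable (\<lambda>r. norm (f r))" "\<And>r. (\<lambda>n. w n r) \<longlonglongrightarrow> L"
    and "\<And>n r. r \<le> n \<Longrightarrow> norm (w n r) \<le> B"
  shows "(\<lambda>n. \<Sum>r\<le>n. f r * w n r) \<longlonglongrightarrow> L * (\<Sum>r. f r)"
proof -
  let ?a = "\<lambda>r n. if r \<le> n then f r * w n r else 0"
  have B: "B \<ge> 0" using assms(3)[of 0 0] norm_ge_zero order_trans by blast
  have "((\<lambda>n. \<Sum>r. ?a r n) \<longlongrightarrow> (\<Sum>r. f r * L)) sequentially"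
  proof (rule tannerys_theorem[THEN conjunct2, THEN conjunct2])
    show "(\<lambda>n. ?a r n) \<longlonglongrightarrow> f r * L" for r
    proof -
      have "(\<lambda>n. f r * w n r) \<longlonglongrightarrow> f r * L"
        by (intro tendsto_intros assms)
      then show ?thesis
        by (rule Lim_transform_eventually)
           (use eventually_ge_at_top[of r] in eventually_elim, simp)
    qed
    show "\<forall>\<^sub>F (r, n) in at_top \<times>\<^sub>F at_top. norm (?a r n) \<le> norm (f r) * B"
      using B assms(3) by (intro always_eventually) (auto simp: norm_mult mult_left_mono)
    show "summable (\<lambda>r. norm (f r) * B)"
      by (intro summable_mult2 assms)
  qed auto
  moreover have "(\<Sum>r. ?a r n) = (\<Sum>r\<le>n. f r * w n r)" for n
    by (subst suminf_finite[of "{..n}"]) auto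
  moreover have "(\<Sum>r. f r * L) = L * (\<Sum>r. f r)"
    using suminf_mult[OF summable_norm_cancel[OF assms(1)], of L] by (simp add: mult.commute)
  ultimately show ?thesis by simp
qed

text \<open>
  The ratio of consecutive terms tends to \<open>0\<close> because of its factor \<open>q^m\<close>.
\<close>

lemma summable_norm_qcv_term:
  assumes "norm q < 1"
  shows "summable (\<lambda>m. norm (qcv_term q y c m))"
proof -
  have q0: "(\<lambda>m. q ^ m) \<longlonglongrightarrow> 0"
    using assms by (rule LIMSEQ_power_zero)
  have "(\<lambda>m. - (q ^ m) * (y - c * q ^ m) / ((1 - q * q ^ m) * (1 - c * q ^ m)))
          \<longlonglongrightarrow> - 0 * (y - c * 0) / ((1 - q * 0) * (1 - c * 0))"
    by (intro tendsto_intros q0) auto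
  then have "(\<lambda>m. norm (- (q ^ m) * (y - c * q ^ m) / ((1 - q ^ Suc m) * (1 - c * q ^ m)))) \<longlonglongrightarrow> 0"
    using tendsto_norm by fastforce
  then have "eventually (\<lambda>m. norm (- (q ^ m) * (y - c * q ^ m) / ((1 - q ^ Suc m) * (1 - c * q ^ m))) < 1/2)
               sequentially"
    by (rule order_tendstoD) simp
  then obtain N where N: "\<And>m. m \<ge> N \<Longrightarrow>
      norm (- (q ^ m) * (y - c * q ^ m) / ((1 - q ^ Suc m) * (1 - c * q ^ m))) < 1/2"
    by (auto simp: eventually_at_top_linorder)
  show ?thesis
  proof (rule summable_ratio_test[of "1/2" N])
    fix m assume "m \<ge> N"
    then have "norm (qcv_term q y c (Suc m)) \<le> norm (qcv_term q y c m) * (1/2)"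
      unfolding qcv_term_Suc norm_mult[of "qcv_term q y c m"]
      using N[of m] by (intro mult_left_mono) (auto simp: less_imp_le)
    then show "norm (norm (qcv_term q y c (Suc m))) \<le> 1/2 * norm (norm (qcv_term q y c m))"
      by simp
  qed simp
qed

text \<open>
  The limit \<open>N \<rightarrow> \<infinity>\<close> of the q-Chu-Vandermonde sum.
\<close>

lemma qcv_term_sums:
  assumes "norm q < 1" "norm c < 1"
  shows "qcv_term q y c sums (qpoch_inf y q / qpoch_inf c q)"
proof -
  obtain B where B: "\<And>n. norm (1 / qpoch q q n) \<le> B"
    using inverse_qpoch_bounded[OF assms(1) assms(1)] by blast
  have nz: "qpoch_inf q q \<noteq> 0" "qpoch_inf c q \<noteq> 0"
    using assms qpoch_inf_nonzero by auto
  have sm: "summable (\<lambda>m. norm (qcv_term q y c m))"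
    by (rule summable_norm_qcv_term) fact
  have "(\<lambda>N. \<Sum>m\<le>N. qcv_term q y c m * (1 / qpoch q q (N - m)))
          \<longlonglongrightarrow> 1 / qpoch_inf q q * (\<Sum>m. qcv_term q y c m)"
  proof (rule tendsto_weighted_sum[OF sm])
    show "(\<lambda>n. 1 / qpoch q q (n - r)) \<longlonglongrightarrow> 1 / qpoch_inf q q" for r
    proof (rule LIMSEQ_offset[of _ r])
      show "(\<lambda>n. 1 / qpoch q q (n + r - r)) \<longlonglongrightarrow> 1 / qpoch_inf q q"
        using nz by (simp add: tendsto_divide[OF tendsto_const qpoch_tendsto[OF assms(1)]])
    qed
  qed (rule B)
  moreover have "(\<lambda>N. qpoch y q N / (qpoch q q N * qpoch c q N))
          \<longlonglongrightarrow> qpoch_inf y q / (qpoch_inf q q * qpoch_inf c q)"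
    using nz by (intro tendsto_intros qpoch_tendsto assms) auto
  moreover have "(\<Sum>m\<le>N. qcv_term q y c m * (1 / qpoch q q (N - m)))
                   = qpoch y q N / (qpoch q q N * qpoch c q N)" for N
    using q_chu_vandermonde[OF assms(1), of c y N] mult_power_neq_1[OF assms(2,1)] by simp
  ultimately have "1 / qpoch_inf q q * (\<Sum>m. qcv_term q y c m)
                     = qpoch_inf y q / (qpoch_inf q q * qpoch_inf c q)"
    using LIMSEQ_unique by fastforce
  then have "(\<Sum>m. qcv_term q y c m) = qpoch_inf y q / qpoch_inf c q"
    using nz by (simp add: field_simps)
  then show ?thesis
    using summable_norm_cancel[OF sm] by (simp add: sums_iff)
qed

section \<open>Bailey pairs\<close>

definition bailey_pair :: "complex \<Rightarrow> complex \<Rightarrow> (nat \<Rightarrow> complex) \<Rightarrow> (nat \<Rightarrow> complex) \<Rightarrow> bool" where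
  "bailey_pair a q \<alpha> \<beta> \<longleftrightarrow>
     (\<forall>n. \<beta> n = (\<Sum>r\<le>n. \<alpha> r / (qpoch q q (n - r) * qpoch (a * q) q (n + r))))"

text \<open>
  The factor \<open>(\<rho>;q)_k (-x)^k q^(k choose 2)\<close> of Bailey's lemma with one finite parameter
  \<open>\<rho> = a q / x\<close>, the other parameter having been sent to infinity.  As in \<open>qcv_term\<close>, the product
  form avoids dividing by \<open>x\<close>.
\<close>

definition bailey_weight :: "complex \<Rightarrow> complex \<Rightarrow> complex \<Rightarrow> nat \<Rightarrow> complex" where
  "bailey_weight a q x k = (-1) ^ k * q ^ (k choose 2) * (\<Prod>i<k. x - a * q ^ Suc i)"

lemma choose_two_add: "(m + n) choose 2 = (m choose 2) + (n choose 2) + m * n"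
  by (induction n) (simp_all add: choose_two_Suc)

lemma prod_add_lessThan:
  fixes f :: "nat \<Rightarrow> complex"
  shows "(\<Prod>i<m + n. f i) = (\<Prod>i<m. f i) * (\<Prod>i<n. f (m + i))"
  by (induction n) (simp_all add: mult_ac)

text \<open>
  Re-indexing \<open>k = r + m\<close> in the sum of Bailey's lemma turns its terms into those of a
  q-Chu-Vandermonde sum with shifted parameters.
\<close>

lemma bailey_weight_add:
  "bailey_weight a q x (r + m) / (qpoch q q m * qpoch (a * q) q (2 * r + m)) =
     bailey_weight a q x r / qpoch (a * q) q (2 * r)
       * qcv_term q (x * q ^ r) (a * q ^ Suc (2 * r)) m"
proof -
  have "q ^ (r * m) * (\<Prod>i<m. x - a * q ^ Suc (r + i)) = (\<Prod>i<m. q ^ r * (x - a * q ^ Suc (r + i)))"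
    by (simp add: prod.distrib power_mult)
  also have "\<dots> = (\<Prod>i<m. x * q ^ r - a * q ^ Suc (2 * r) * q ^ i)"
    by (rule prod.cong) (simp_all add: algebra_simps power_add mult_2_right)
  finally have shift: "q ^ (r * m) * (\<Prod>i<m. x - a * q ^ Suc (r + i))
      = (\<Prod>i<m. x * q ^ r - a * q ^ Suc (2 * r) * q ^ i)" .
  have "bailey_weight a q x (r + m) = bailey_weight a q x r *
      ((-1) ^ m * q ^ (m choose 2) * (q ^ (r * m) * (\<Prod>i<m. x - a * q ^ Suc (r + i))))"
    unfolding bailey_weight_def choose_two_add prod_add_lessThan power_add
    by (simp add: mult_ac)
  moreover have "qpoch (a * q) q (2 * r + m) = qpoch (a * q) q (2 * r) * qpoch (a * q ^ Suc (2 * r)) q m"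
    by (simp add: qpoch_add mult_ac)
  ultimately show ?thesis
    unfolding shift qcv_term_def by simp
qed

lemma sum_triangle_swap:
  fixes f :: "nat \<Rightarrow> nat \<Rightarrow> complex"
  shows "(\<Sum>k\<le>n. \<Sum>r\<le>k. f k r) = (\<Sum>r\<le>n. \<Sum>m\<le>n - r. f (r + m) r)"
  unfolding sum.Sigma[OF finite_atMost ballI[OF finite_atMost]]
  by (rule sum.reindex_bij_witness[of _ "\<lambda>(r, m). (r + m, r)" "\<lambda>(k, r). (r, k - r)"]) auto

text \<open>
  Inserting the definition of \<open>\<beta>\<close> and exchanging the two sums leaves, for each \<open>r\<close>, a
  q-Chu-Vandermonde sum over \<open>m = k - r\<close>.  The usual denominator \<open>(x;q)_n\<close> of the transformed pair is
  absorbed by multiplying with \<open>(x q^n;q)_inf\<close>, which also admits values of \<open>x\<close> where it vanishes.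
\<close>

lemma bailey_lemma:
  assumes q: "norm q < 1" and aq: "norm (a * q) < 1" and bp: "bailey_pair a q \<alpha> \<beta>"
  shows "(\<Sum>k\<le>n. bailey_weight a q x k * \<beta> k / qpoch q q (n - k)) * qpoch_inf (x * q ^ n) q =
     (\<Sum>r\<le>n. bailey_weight a q x r * \<alpha> r * qpoch_inf (x * q ^ r) q
        / (qpoch q q (n - r) * qpoch (a * q) q (n + r)))"
proof -
  let ?P = "qpoch q q" and ?A = "qpoch (a * q) q" and ?W = "bailey_weight a q x"
  have "(\<Sum>k\<le>n. ?W k * \<beta> k / ?P (n - k))
      = (\<Sum>k\<le>n. \<Sum>r\<le>k. ?W k * (\<alpha> r / (?P (k - r) * ?A (k + r))) / ?P (n - k))"
    using bp by (simp add: bailey_pair_def sum_distrib_left sum_divide_distrib)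
  also have "\<dots> = (\<Sum>r\<le>n. \<Sum>m\<le>n - r. ?W (r + m) * (\<alpha> r / (?P (r + m - r) * ?A (r + m + r))) / ?P (n - (r + m)))"
    by (rule sum_triangle_swap)
  also have "\<dots> = (\<Sum>r\<le>n. \<alpha> r * ?W r / ?A (2 * r) *
      (\<Sum>m\<le>n - r. qcv_term q (x * q ^ r) (a * q ^ Suc (2 * r)) m / ?P (n - r - m)))"
  proof (intro sum.cong refl, unfold sum_distrib_left, intro sum.cong refl)
    fix r m
    have "?W (r + m) * (\<alpha> r / (?P (r + m - r) * ?A (r + m + r))) / ?P (n - (r + m))
        = \<alpha> r * (?W (r + m) / (?P m * ?A (2 * r + m))) / ?P (n - r - m)"
      by (simp add: mult_ac mult_2_right add_ac)
    then show "?W (r + m) * (\<alpha> r / (?P (r + m - r) * ?A (r + m + r))) / ?P (n - (r + m))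
        = \<alpha> r * ?W r / ?A (2 * r) * (qcv_term q (x * q ^ r) (a * q ^ Suc (2 * r)) m / ?P (n - r - m))"
      unfolding bailey_weight_add by simp
  qed
  also have "\<dots> = (\<Sum>r\<le>n. \<alpha> r * ?W r / ?A (2 * r) *
      (qpoch (x * q ^ r) q (n - r) / (?P (n - r) * qpoch (a * q ^ Suc (2 * r)) q (n - r))))"
  proof (intro sum.cong refl arg_cong2[where f = "(*)"] q_chu_vandermonde q)
    show "a * q ^ Suc (2 * r) * q ^ m \<noteq> 1" for r m
      using mult_power_neq_1[OF aq q, of "2 * r + m"] by (simp add: power_add mult_ac)
  qed
  also have "\<dots> = (\<Sum>r\<le>n. ?W r * \<alpha> r * qpoch (x * q ^ r) q (n - r) / (?P (n - r) * ?A (n + r)))"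
  proof (intro sum.cong refl)
    fix r assume "r \<in> {..n}"
    then have "?A (n + r) = ?A (2 * r) * qpoch (a * q ^ Suc (2 * r)) q (n - r)"
      using qpoch_add[of "a * q" q "2 * r" "n - r"] by (simp add: mult_ac add_ac)
    then show "\<alpha> r * ?W r / ?A (2 * r) *
      (qpoch (x * q ^ r) q (n - r) / (?P (n - r) * qpoch (a * q ^ Suc (2 * r)) q (n - r)))
      = ?W r * \<alpha> r * qpoch (x * q ^ r) q (n - r) / (?P (n - r) * ?A (n + r))"
      by (simp add: mult_ac)
  qed
  finally have inner: "(\<Sum>k\<le>n. ?W k * \<beta> k / ?P (n - k))
      = (\<Sum>r\<le>n. ?W r * \<alpha> r * qpoch (x * q ^ r) q (n - r) / (?P (n - r) * ?A (n + r)))" .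
  have "(\<Sum>k\<le>n. ?W k * \<beta> k / ?P (n - k)) * qpoch_inf (x * q ^ n) q
      = (\<Sum>r\<le>n. ?W r * \<alpha> r * (qpoch (x * q ^ r) q (n - r) * qpoch_inf (x * q ^ n) q)
          / (?P (n - r) * ?A (n + r)))"
    unfolding inner sum_distrib_right by (simp add: mult_ac)
  also have "\<dots> = (\<Sum>r\<le>n. ?W r * \<alpha> r * qpoch_inf (x * q ^ r) q / (?P (n - r) * ?A (n + r)))"
  proof (intro sum.cong refl)
    fix r assume "r \<in> {..n}"
    then have "qpoch_inf (x * q ^ r) q = qpoch (x * q ^ r) q (n - r) * qpoch_inf (x * q ^ n) q"
      using qpoch_inf_split[OF q, of "x * q ^ r" "n - r"] by (simp add: mult.assoc power_add[symmetric])
    then show "?W r * \<alpha> r * (qpoch (x * q ^ r) q (n - r) * qpoch_inf (x * q ^ n) q) / (?P (n - r) * ?A (n + r))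
        = ?W r * \<alpha> r * qpoch_inf (x * q ^ r) q / (?P (n - r) * ?A (n + r))"
      by simp
  qed
  finally show ?thesis .
qed

text \<open>
  For fixed \<open>r\<close> the denominators of a Bailey pair converge to \<open>(q;q)_inf (a q;q)_inf\<close>, so the limit
  of \<open>\<beta>\<close> evaluates the series of \<open>\<alpha>\<close>.
\<close>

lemma bailey_pair_limit:
  assumes q: "norm q < 1" and aq: "norm (a * q) < 1" and bp: "bailey_pair a q \<alpha> \<beta>"
    and \<alpha>: "summable (\<lambda>r. norm (\<alpha> r))" and lim: "\<beta> \<longlonglongrightarrow> L"
  shows "\<alpha> sums (L * (qpoch_inf q q * qpoch_inf (a * q) q))"
proof -
  let ?P = "qpoch q q" and ?A = "qpoch (a * q) q"
  obtain B where B: "\<And>n. norm (1 / ?P n) \<le> B" "B > 0"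
    using inverse_qpoch_bounded[OF q q] by blast
  obtain C where C: "\<And>n. norm (1 / ?A n) \<le> C" "C > 0"
    using inverse_qpoch_bounded[OF aq q] by blast
  have nz: "qpoch_inf q q \<noteq> 0" "qpoch_inf (a * q) q \<noteq> 0"
    using q aq qpoch_inf_nonzero by auto
  have "(\<lambda>n. \<Sum>r\<le>n. \<alpha> r * (1 / (?P (n - r) * ?A (n + r))))
          \<longlonglongrightarrow> 1 / (qpoch_inf q q * qpoch_inf (a * q) q) * (\<Sum>r. \<alpha> r)"
  proof (rule tendsto_weighted_sum[OF \<alpha>])
    show "(\<lambda>n. 1 / (?P (n - r) * ?A (n + r))) \<longlonglongrightarrow> 1 / (qpoch_inf q q * qpoch_inf (a * q) q)" for r
    proof (rule LIMSEQ_offset[of _ r])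
      have "(\<lambda>n. ?A (n + 2 * r)) \<longlonglongrightarrow> qpoch_inf (a * q) q"
        by (intro LIMSEQ_ignore_initial_segment qpoch_tendsto q)
      then have "(\<lambda>n. 1 / (?P n * ?A (n + 2 * r))) \<longlonglongrightarrow> 1 / (qpoch_inf q q * qpoch_inf (a * q) q)"
        using nz by (intro tendsto_intros qpoch_tendsto q) auto
      then show "(\<lambda>n. 1 / (?P (n + r - r) * ?A (n + r + r))) \<longlonglongrightarrow> 1 / (qpoch_inf q q * qpoch_inf (a * q) q)"
        by (simp add: mult_2 add.assoc)
    qed
    have "norm (1 / ?P m * (1 / ?A n)) \<le> B * C" for m n
      unfolding norm_mult using B C by (intro mult_mono) (auto simp: less_imp_le)
    then show "norm (1 / (?P (n - r) * ?A (n + r))) \<le> B * C" for n r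
      by simp
  qed
  moreover have "(\<Sum>r\<le>n. \<alpha> r * (1 / (?P (n - r) * ?A (n + r)))) = \<beta> n" for n
    using bp by (simp add: bailey_pair_def)
  ultimately have "1 / (qpoch_inf q q * qpoch_inf (a * q) q) * (\<Sum>r. \<alpha> r) = L"
    using lim LIMSEQ_unique by fastforce
  then have "(\<Sum>r. \<alpha> r) = L * (qpoch_inf q q * qpoch_inf (a * q) q)"
    using nz by (simp add: field_simps)
  then show ?thesis
    using summable_norm_cancel[OF \<alpha>] by (simp add: sums_iff)
qed

section \<open>Summing over Bailey pairs\<close>

text \<open>
  The case \<open>y = 0\<close>, \<open>c = a q^(2r+1)\<close> of \<open>qcv_term_sums\<close>.  For \<open>a = 1\<close> and \<open>r = 0\<close> it is the count
  of partitions by the size \<open>m\<close> of their Durfee square.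
\<close>

lemma durfee_sum:
  assumes q: "norm q < 1" and a: "norm a \<le> 1"
  shows "(\<lambda>m. a ^ (r + m) * q ^ ((r + m)\<^sup>2) / (qpoch q q m * qpoch (a * q) q (2 * r + m)))
           sums (a ^ r * q ^ (r\<^sup>2) / qpoch_inf (a * q) q)"
proof -
  let ?c = "a * q ^ Suc (2 * r)"
  have aq: "norm (a * q) < 1"
    using q a mult_right_mono[OF a, of "norm q"] by (simp add: norm_mult)
  have c: "norm ?c < 1"
    using norm_mult_power_less_1[OF aq q, of "2 * r"] by (simp add: mult_ac)
  have "qcv_term q 0 ?c m = ?c ^ m * q ^ (2 * (m choose 2)) / (qpoch q q m * qpoch ?c q m)" for m
  proof -
    have "(\<Prod>i<m. q ^ i) = q ^ (m choose 2)"
      by (induction m) (simp_all add: choose_two_Suc power_add binomial_eq_0)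
    then have "(\<Prod>i<m. 0 - ?c * q ^ i) = (-1) ^ m * ?c ^ m * q ^ (m choose 2)"
      by (simp add: prod.distrib prod_uminus del: power_Suc)
    moreover have "(-1) ^ m * ((-1) ^ m * z) = z" for z :: complex
      by (simp add: mult.assoc[symmetric] power_mult_distrib[symmetric])
    ultimately show ?thesis
      unfolding qcv_term_def by (simp add: mult_2 power_add mult_ac del: power_Suc)
  qed
  moreover have "a ^ (r + m) * q ^ ((r + m)\<^sup>2) = a ^ r * q ^ (r\<^sup>2) * (?c ^ m * q ^ (2 * (m choose 2)))" for m
  proof -
    have "(r + m)\<^sup>2 = r\<^sup>2 + (Suc (2 * r) * m + 2 * (m choose 2))"
      using square_eq_choose_two[of m] by (simp add: power2_sum)
    moreover have "?c ^ m = a ^ m * q ^ (Suc (2 * r) * m)"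
      by (simp only: power_mult_distrib power_mult)
    ultimately show ?thesis
      by (simp only: power_add mult_ac)
  qed
  moreover have "qpoch (a * q) q (2 * r + m) = qpoch (a * q) q (2 * r) * qpoch ?c q m" for m
    by (simp add: qpoch_add mult_ac)
  ultimately have "a ^ (r + m) * q ^ ((r + m)\<^sup>2) / (qpoch q q m * qpoch (a * q) q (2 * r + m))
      = a ^ r * q ^ (r\<^sup>2) / qpoch (a * q) q (2 * r) * qcv_term q 0 ?c m" for m
    by (simp add: mult_ac del: power_Suc)
  moreover have "(\<lambda>m. a ^ r * q ^ (r\<^sup>2) / qpoch (a * q) q (2 * r) * qcv_term q 0 ?c m)
      sums (a ^ r * q ^ (r\<^sup>2) / qpoch (a * q) q (2 * r) * (qpoch_inf 0 q / qpoch_inf ?c q))"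
    by (intro sums_mult qcv_term_sums q c)
  moreover have "qpoch_inf (a * q) q = qpoch (a * q) q (2 * r) * qpoch_inf ?c q"
    using qpoch_inf_split[OF q, of "a * q" "2 * r"] by (simp add: mult_ac)
  moreover have "qpoch_inf 0 q = 1"
    by (simp add: qpoch_inf_def)
  ultimately show ?thesis by simp
qed

lemma euler_sum:
  assumes "norm q < 1"
  shows "(\<lambda>i. (-y) ^ i * q ^ (i choose 2) / qpoch q q i) sums qpoch_inf y q"
proof -
  have "qcv_term q y 0 = (\<lambda>i. (-y) ^ i * q ^ (i choose 2) / qpoch q q i)"
  proof
    fix i
    have "qpoch 0 q i = 1" by (simp add: qpoch_def)
    then show "qcv_term q y 0 i = (-y) ^ i * q ^ (i choose 2) / qpoch q q i"
      using power_mult_distrib[of "-1" y i] by (simp add: qcv_term_def)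
  qed
  moreover have "qpoch_inf 0 q = 1"
    by (simp add: qpoch_inf_def)
  ultimately show ?thesis
    using qcv_term_sums[OF assms, of 0 y] by simp
qed

lemma summable_on_product:
  fixes f :: "'a \<Rightarrow> real" and g :: "'b \<Rightarrow> real"
  assumes "f summable_on A" "g summable_on B" "\<And>x. f x \<ge> 0" "\<And>y. g y \<ge> 0"
  shows "(\<lambda>(x, y). f x * g y) summable_on A \<times> B"
proof (rule summable_on_SigmaI)
  show "((\<lambda>y. case (x, y) of (x, y) \<Rightarrow> f x * g y) has_sum f x * infsum g B) B" for x
    using has_sum_cmult_right[OF has_sum_infsum[OF assms(2)]] by simp
  show "(\<lambda>x. f x * infsum g B) summable_on A"
    by (intro summable_on_cmult_left assms)
qed (use assms in auto)

lemma summable_on_power: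
  assumes "norm (x::complex) < 1"
  shows "(\<lambda>n. norm x ^ n) summable_on UNIV"
  using assms by (intro summable_nonneg_imp_summable_on summable_geometric) auto

lemma norm_power_le_power:
  assumes "norm (q::complex) < 1" "m \<le> n"
  shows "norm (q ^ n) \<le> norm q ^ m"
  unfolding norm_power using assms by (intro power_decreasing) auto

text \<open>
  The limiting form of Bailey's lemma, applied to the pair that \<open>bailey_lemma\<close> produces.  After
  the substitution \<open>n = r + m\<close> the double series is dominated by a product of two convergent
  series in \<open>r\<close> and \<open>m\<close>, so the sum over \<open>m\<close> may be taken first; it is \<open>durfee_sum\<close>.
\<close>

theorem bailey_sum:
  assumes q: "norm q < 1" and a: "norm a \<le> 1" and bp: "bailey_pair a q \<alpha> \<beta>"
    and \<alpha>: "summable (\<lambda>r. norm (bailey_weight a q x r * \<alpha> r))"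
    and T: "(\<lambda>r. a ^ r * q ^ (r\<^sup>2) * (bailey_weight a q x r * \<alpha> r * qpoch_inf (x * q ^ r) q)) sums T"
  shows "((\<lambda>n. a ^ n * q ^ (n\<^sup>2) * qpoch_inf (x * q ^ n) q *
             (\<Sum>k\<le>n. bailey_weight a q x k * \<beta> k / qpoch q q (n - k)))
          has_sum (T / qpoch_inf (a * q) q)) UNIV"
proof -
  let ?P = "qpoch q q" and ?A = "qpoch (a * q) q" and ?W = "bailey_weight a q x"
  define u where "u r = ?W r * \<alpha> r * qpoch_inf (x * q ^ r) q" for r
  define v where "v r m = a ^ (r + m) * q ^ ((r + m)\<^sup>2) / (?P m * ?A (2 * r + m))" for r m
  have aq: "norm (a * q) < 1"
    using q a mult_right_mono[OF a, of "norm q"] by (simp add: norm_mult)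
  obtain B where B: "\<And>n. norm (1 / ?P n) \<le> B" "B > 0"
    using inverse_qpoch_bounded[OF q q] by blast
  obtain C where C: "\<And>n. norm (1 / ?A n) \<le> C" "C > 0"
    using inverse_qpoch_bounded[OF aq q] by blast
  \<comment> \<open>Euler's series bounds \<open>(x q^r;q)_inf\<close> uniformly in \<open>r\<close>, since \<open>norm (x q^r) \<le> norm x\<close>.\<close>
  obtain D where D: "\<And>r. norm (qpoch_inf (x * q ^ r) q) \<le> D" "D > 0"
  proof -
    have sm: "summable (\<lambda>i. (norm x) ^ i * norm (q ^ (i choose 2)) / norm (?P i))"
      using summable_norm_qcv_term[OF q, of x 0]
      by (simp add: qcv_term_def qpoch_def norm_mult norm_divide norm_power mult_ac)
    have "norm (qpoch_inf (x * q ^ r) q) \<le> (\<Sum>i. (norm x) ^ i * norm (q ^ (i choose 2)) / norm (?P i))" for r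
    proof -
      have "norm (x * q ^ r) \<le> norm x"
        unfolding norm_mult norm_power using q by (intro mult_left_le power_le_one) auto
      then have "norm ((- (x * q ^ r)) ^ i * q ^ (i choose 2) / ?P i)
          \<le> norm x ^ i * norm (q ^ (i choose 2)) / norm (?P i)" for i
        unfolding norm_mult[of "_ ^ i"] norm_divide norm_power[of "- _"] norm_minus_cancel
        by (intro divide_right_mono mult_right_mono power_mono) auto
      then show ?thesis
        unfolding sums_unique[OF euler_sum[OF q, of "x * q ^ r"]] using sm by (rule norm_suminf_le)
    qed
    then show ?thesis
      by (intro that[of "max 1 (\<Sum>i. (norm x) ^ i * norm (q ^ (i choose 2)) / norm (?P i))"])
         (auto simp: le_max_iff_disj)
  qed
  have v_bound: "norm (v r m) \<le> norm q ^ m * (B * C)" for r m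
  proof -
    have "m \<le> (r + m)\<^sup>2"
      using le_square[of "r + m"] unfolding power2_eq_square by linarith
    then have "norm (q ^ ((r + m)\<^sup>2)) \<le> norm q ^ m"
      by (rule norm_power_le_power[OF q])
    moreover have "norm (a ^ (r + m)) \<le> 1"
      unfolding norm_power using a by (intro power_le_one) auto
    ultimately have "norm (a ^ (r + m)) * norm (q ^ ((r + m)\<^sup>2)) \<le> 1 * norm q ^ m"
      by (intro mult_mono) auto
    moreover have "norm (1 / ?P m) * norm (1 / ?A (2 * r + m)) \<le> B * C"
      using B C by (intro mult_mono) (auto simp: less_imp_le)
    ultimately have "norm (a ^ (r + m)) * norm (q ^ ((r + m)\<^sup>2)) * (norm (1 / ?P m) * norm (1 / ?A (2 * r + m)))
        \<le> (1 * norm q ^ m) * (B * C)"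
      by (rule mult_mono) auto
    then show ?thesis
      by (simp add: v_def norm_mult norm_divide)
  qed
  have "(\<lambda>(r, m). norm (?W r * \<alpha> r) * norm q ^ m) summable_on UNIV \<times> UNIV"
    by (intro summable_on_product summable_on_power q summable_nonneg_imp_summable_on \<alpha>) auto
  then have "(\<lambda>rm. D * (B * C) * (case rm of (r, m) \<Rightarrow> norm (?W r * \<alpha> r) * norm q ^ m)) summable_on UNIV \<times> UNIV"
    by (rule summable_on_cmult_right)
  then have "(\<lambda>rm. norm (case rm of (r, m) \<Rightarrow> u r * v r m)) summable_on UNIV \<times> UNIV"
  proof (rule Infinite_Sum.abs_summable_on_comparison_test')
    fix rm :: "nat \<times> nat"
    obtain r m where rm: "rm = (r, m)" by fastforce
    have "norm (u r) \<le> norm (?W r * \<alpha> r) * D"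
      unfolding u_def norm_mult[of "_ * _"] using D by (intro mult_left_mono) auto
    then have "norm (u r) * norm (v r m) \<le> (norm (?W r * \<alpha> r) * D) * (norm q ^ m * (B * C))"
      using D(2) by (intro mult_mono v_bound) auto
    then show "norm (case rm of (r, m) \<Rightarrow> u r * v r m)
        \<le> D * (B * C) * (case rm of (r, m) \<Rightarrow> norm (?W r * \<alpha> r) * norm q ^ m)"
      by (simp add: rm norm_mult mult_ac)
  qed
  then have summ: "(\<lambda>(r, m). u r * v r m) summable_on UNIV \<times> UNIV"
    by (rule Infinite_Sum.abs_summable_summable)
  have inner: "((\<lambda>m. u r * v r m) has_sum (u r * (a ^ r * q ^ (r\<^sup>2) / qpoch_inf (a * q) q))) UNIV" for r
  proof (intro has_sum_cmult_right norm_summable_imp_has_sum)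
    show "summable (\<lambda>m. norm (v r m))"
      by (rule summable_comparison_test'[of "\<lambda>m. norm q ^ m * (B * C)" 0])
         (use q v_bound in \<open>auto intro!: summable_mult2 summable_geometric\<close>)
    show "v r sums (a ^ r * q ^ (r\<^sup>2) / qpoch_inf (a * q) q)"
      unfolding v_def using q a by (rule durfee_sum)
  qed
  have "(\<lambda>r. norm (a ^ r * q ^ (r\<^sup>2) * u r)) summable_on UNIV"
    unfolding u_def
  proof (rule Infinite_Sum.abs_summable_on_comparison_test')
    show "(\<lambda>r. norm (?W r * \<alpha> r) * D) summable_on UNIV"
      by (intro summable_on_cmult_left summable_nonneg_imp_summable_on \<alpha>) auto
    fix r
    have "norm (a ^ r) * norm (q ^ (r\<^sup>2)) \<le> 1 * 1"
      unfolding norm_power using q a by (intro mult_mono power_le_one) auto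
    moreover have "norm (?W r * \<alpha> r * qpoch_inf (x * q ^ r) q) \<le> norm (?W r * \<alpha> r) * D"
      unfolding norm_mult[of "_ * _"] using D by (intro mult_left_mono) auto
    ultimately have "(norm (a ^ r) * norm (q ^ (r\<^sup>2))) * norm (?W r * \<alpha> r * qpoch_inf (x * q ^ r) q)
        \<le> (1 * 1) * (norm (?W r * \<alpha> r) * D)"
      by (rule mult_mono) auto
    then show "norm (a ^ r * q ^ (r\<^sup>2) * (?W r * \<alpha> r * qpoch_inf (x * q ^ r) q)) \<le> norm (?W r * \<alpha> r) * D"
      by (simp add: norm_mult)
  qed
  then have "summable (\<lambda>r. norm (a ^ r * q ^ (r\<^sup>2) * u r))"
    by (rule summable_on_imp_summable)
  then have "((\<lambda>r. a ^ r * q ^ (r\<^sup>2) * u r) has_sum T) UNIV"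
    by (rule norm_summable_imp_has_sum) (use T in \<open>simp add: u_def\<close>)
  then have "((\<lambda>r. a ^ r * q ^ (r\<^sup>2) * u r * (1 / qpoch_inf (a * q) q))
      has_sum (T * (1 / qpoch_inf (a * q) q))) UNIV"
    by (rule has_sum_cmult_left)
  then have outer: "((\<lambda>r. u r * (a ^ r * q ^ (r\<^sup>2) / qpoch_inf (a * q) q)) has_sum (T / qpoch_inf (a * q) q)) UNIV"
    by (simp add: mult_ac)
  have "((\<lambda>(r, m). u r * v r m) has_sum (T / qpoch_inf (a * q) q)) (UNIV \<times> UNIV)"
    by (rule has_sum_SigmaI[OF _ outer summ]) (use inner in simp)
  also have "?this \<longleftrightarrow> ((\<lambda>(n, r). u r * v r (n - r)) has_sum (T / qpoch_inf (a * q) q)) (SIGMA n:UNIV. {..n})"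
    by (rule has_sum_reindex_bij_witness[of _ "\<lambda>(n, r). (r, n - r)" "\<lambda>(r, m). (r + m, r)"]) auto
  finally have "((\<lambda>n. \<Sum>r\<le>n. u r * v r (n - r)) has_sum (T / qpoch_inf (a * q) q)) UNIV"
    by (rule has_sum_SigmaD) simp
  moreover have "(\<Sum>r\<le>n. u r * v r (n - r)) = a ^ n * q ^ (n\<^sup>2) * qpoch_inf (x * q ^ n) q *
             (\<Sum>k\<le>n. ?W k * \<beta> k / ?P (n - k))" for n
  proof -
    have "u r * v r (n - r) = a ^ n * q ^ (n\<^sup>2) * (?W r * \<alpha> r * qpoch_inf (x * q ^ r) q
            / (?P (n - r) * ?A (n + r)))" if "r \<le> n" for r
      using that by (simp add: u_def v_def mult_2 mult_ac add_ac)
    then have "(\<Sum>r\<le>n. u r * v r (n - r)) = a ^ n * q ^ (n\<^sup>2) *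
        (\<Sum>r\<le>n. ?W r * \<alpha> r * qpoch_inf (x * q ^ r) q / (?P (n - r) * ?A (n + r)))"
      by (simp add: sum_distrib_left)
    then show ?thesis
      unfolding bailey_lemma[OF q aq bp, symmetric] by (simp add: mult_ac)
  qed
  ultimately show ?thesis by simp
qed

text \<open>
  The sum over \<open>i\<close> is Euler's series for \<open>(x q^(j+k);q)_inf\<close>; grouping the remaining double sum by
  \<open>n = j + k\<close> gives \<open>bailey_sum\<close>.
\<close>

theorem bailey_triple_sum:
  assumes q: "norm q < 1" and a: "norm a \<le> 1" and x: "norm x < 1" and bp: "bailey_pair a q \<alpha> \<beta>"
    and \<alpha>: "summable (\<lambda>r. norm (bailey_weight a q x r * \<alpha> r))"
    and \<beta>: "summable (\<lambda>k. norm (bailey_weight a q x k * \<beta> k))"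
    and T: "(\<lambda>r. a ^ r * q ^ (r\<^sup>2) * (bailey_weight a q x r * \<alpha> r * qpoch_inf (x * q ^ r) q)) sums T"
  shows "((\<lambda>(i, j, k). (- x) ^ i * q ^ ((i choose 2) + i * (j + k)) * (a ^ (j + k) * q ^ ((j + k)\<^sup>2))
              * (bailey_weight a q x k * \<beta> k) / (qpoch q q i * qpoch q q j))
          has_sum (T / qpoch_inf (a * q) q)) (UNIV :: (nat \<times> nat \<times> nat) set)"
proof -
  let ?P = "qpoch q q" and ?W = "bailey_weight a q x"
  define f where "f = (\<lambda>(i, j, k). (- x) ^ i * q ^ ((i choose 2) + i * (j + k)) *
      (a ^ (j + k) * q ^ ((j + k)\<^sup>2)) * (?W k * \<beta> k) / (?P i * ?P j))"
  obtain B where B: "\<And>n. norm (1 / ?P n) \<le> B" "B > 0"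
    using inverse_qpoch_bounded[OF q q] by blast
  have "(\<lambda>(j, k). norm q ^ j * norm (?W k * \<beta> k)) summable_on UNIV \<times> UNIV"
    by (intro summable_on_product summable_on_power q summable_nonneg_imp_summable_on \<beta>) auto
  then have "(\<lambda>(i, jk). norm x ^ i * (case jk of (j, k) \<Rightarrow> norm q ^ j * norm (?W k * \<beta> k)))
          summable_on UNIV \<times> (UNIV \<times> UNIV)"
    by (intro summable_on_product[OF summable_on_power[OF x]]) auto
  then have "(\<lambda>ijk. (B * B) * (case ijk of (i, j, k) \<Rightarrow> norm x ^ i * (norm q ^ j * norm (?W k * \<beta> k))))
          summable_on UNIV"
    by (intro summable_on_cmult_right) (simp add: case_prod_unfold)
  then have "(\<lambda>ijk. norm (f ijk)) summable_on UNIV"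
  proof (rule Infinite_Sum.abs_summable_on_comparison_test')
    fix ijk :: "nat \<times> nat \<times> nat"
    obtain i j k where ijk: "ijk = (i, j, k)" by (metis surj_pair)
    have "j \<le> (j + k)\<^sup>2"
      using le_square[of "j + k"] unfolding power2_eq_square by linarith
    then have "norm (q ^ ((j + k)\<^sup>2)) \<le> norm q ^ j"
      by (rule norm_power_le_power[OF q])
    moreover have "norm (a ^ (j + k)) \<le> 1"
      unfolding norm_power using a by (intro power_le_one) auto
    ultimately have 1: "norm (a ^ (j + k)) * norm (q ^ ((j + k)\<^sup>2)) \<le> 1 * norm q ^ j"
      by (intro mult_mono) auto
    have "norm (q ^ ((i choose 2) + i * (j + k))) \<le> norm q ^ 0"
      by (rule norm_power_le_power[OF q]) simp
    then have 2: "norm x ^ i * norm (q ^ ((i choose 2) + i * (j + k))) \<le> norm x ^ i"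
      by (intro mult_left_le) auto
    have 3: "norm (1 / ?P i) * norm (1 / ?P j) \<le> B * B"
      using B by (intro mult_mono) (auto simp: less_imp_le)
    have "(norm x ^ i * norm (q ^ ((i choose 2) + i * (j + k)))) * (norm (a ^ (j + k)) * norm (q ^ ((j + k)\<^sup>2)))
        * norm (?W k * \<beta> k) * (norm (1 / ?P i) * norm (1 / ?P j))
      \<le> norm x ^ i * (1 * norm q ^ j) * norm (?W k * \<beta> k) * (B * B)"
      by (intro mult_mono[OF mult_right_mono[OF mult_mono[OF 2 1]] 3]) auto
    then show "norm (f ijk) \<le> (B * B) * (case ijk of (i, j, k) \<Rightarrow> norm x ^ i * (norm q ^ j * norm (?W k * \<beta> k)))"
      by (simp add: f_def ijk norm_mult norm_divide norm_power mult_ac)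
  qed
  then have summ: "f summable_on UNIV"
    by (rule Infinite_Sum.abs_summable_summable)
  let ?S = "SIGMA n:UNIV. {..n} \<times> (UNIV :: nat set)"
  let ?g = "\<lambda>(n, k, i). f (i, n - k, k)"
  have "f summable_on UNIV \<longleftrightarrow> ?g summable_on ?S"
    by (rule summable_on_reindex_bij_witness[of _ "\<lambda>(n, k, i). (i, n - k, k)" "\<lambda>(i, j, k). (j + k, k, i)"]) auto
  with summ have summ': "?g summable_on ?S" by simp
  define h where "h n k = a ^ n * q ^ (n\<^sup>2) * qpoch_inf (x * q ^ n) q * (?W k * \<beta> k / ?P (n - k))" for n k
  have inner_i: "((\<lambda>i. ?g (n, k, i)) has_sum h n k) UNIV" if "k \<le> n" for n k
  proof -
    have "summable (\<lambda>i. norm (qcv_term q (x * q ^ n) 0 i))"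
      by (rule summable_norm_qcv_term) fact
    moreover have "qcv_term q (x * q ^ n) 0 = (\<lambda>i. (- (x * q ^ n)) ^ i * q ^ (i choose 2) / ?P i)"
      using power_mult_distrib[of "-1" "x * q ^ n"] by (auto simp: qcv_term_def qpoch_def)
    ultimately have "((\<lambda>i. (- (x * q ^ n)) ^ i * q ^ (i choose 2) / ?P i) has_sum qpoch_inf (x * q ^ n) q) UNIV"
      by (intro norm_summable_imp_has_sum euler_sum[OF q]) simp
    then have "((\<lambda>i. a ^ n * q ^ (n\<^sup>2) * (?W k * \<beta> k / ?P (n - k)) *
        ((- (x * q ^ n)) ^ i * q ^ (i choose 2) / ?P i)) has_sum
        (a ^ n * q ^ (n\<^sup>2) * (?W k * \<beta> k / ?P (n - k)) * qpoch_inf (x * q ^ n) q)) UNIV"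
      by (rule has_sum_cmult_right)
    moreover have "a ^ n * q ^ (n\<^sup>2) * (?W k * \<beta> k / ?P (n - k)) *
        ((- (x * q ^ n)) ^ i * q ^ (i choose 2) / ?P i) = ?g (n, k, i)" for i
    proof -
      have "(- (x * q ^ n)) ^ i = (- x) ^ i * q ^ (i * n)"
        using power_mult_distrib[of "- x" "q ^ n" i] by (simp add: power_mult[symmetric] mult.commute)
      then show ?thesis
        using that by (simp add: f_def power_add[of q "i choose 2"] mult_ac)
    qed
    ultimately show ?thesis by (simp add: h_def mult_ac)
  qed
  have inner: "((\<lambda>(k, i). ?g (n, k, i)) has_sum (\<Sum>k\<le>n. h n k)) ({..n} \<times> UNIV)" for n
  proof (rule has_sum_SigmaI)
    show "((\<lambda>i. case (k, i) of (k, i) \<Rightarrow> ?g (n, k, i)) has_sum h n k) UNIV" if "k \<in> {..n}" for k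
      using inner_i[of k n] that by simp
    show "(h n has_sum (\<Sum>k\<le>n. h n k)) {..n}"
      by simp
    have "?g summable_on Pair n ` ({..n} \<times> UNIV)"
      by (rule summable_on_subset_banach[OF summ']) auto
    then show "(\<lambda>(k, i). ?g (n, k, i)) summable_on {..n} \<times> UNIV"
      by (subst (asm) summable_on_reindex) (auto simp: inj_on_def o_def case_prod_unfold)
  qed
  have "((\<lambda>n. \<Sum>k\<le>n. h n k) has_sum (T / qpoch_inf (a * q) q)) UNIV"
    using bailey_sum[OF q a bp \<alpha> T] by (simp add: h_def sum_distrib_left)
  then have "(?g has_sum (T / qpoch_inf (a * q) q)) ?S"
    by (rule has_sum_SigmaI[rotated, OF _ summ']) (use inner in \<open>simp add: case_prod_unfold\<close>)
  also have "?this \<longleftrightarrow> (f has_sum (T / qpoch_inf (a * q) q)) UNIV"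
    by (rule has_sum_reindex_bij_witness[of _ "\<lambda>(i, j, k). (j + k, k, i)" "\<lambda>(n, k, i). (i, n - k, k)"]) auto
  finally show ?thesis unfolding f_def .
qed

lemma bailey_weight_eq:
  assumes "a * q = x * \<rho>"
  shows "bailey_weight a q x k = (- x) ^ k * q ^ (k choose 2) * qpoch \<rho> q k"
proof -
  have "x - a * q ^ Suc i = x * (1 - \<rho> * q ^ i)" for i
  proof -
    have "a * q ^ Suc i = x * \<rho> * q ^ i"
      using assms by simp
    then show ?thesis
      by (simp only: right_diff_distrib mult_1_right mult.assoc)
  qed
  moreover have "(- x) ^ k = (-1) ^ k * x ^ k"
    using power_mult_distrib[of "-1" x k] by simp
  ultimately show ?thesis
    by (simp add: bailey_weight_def qpoch_def prod.distrib del: power_Suc)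
qed

lemma summable_bailey_weight:
  assumes q: "norm q < 1" and x: "norm x < 1" and \<rho>: "a * q = x * \<rho>" and f: "\<And>k. norm (f k) \<le> K"
  shows "summable (\<lambda>k. norm (bailey_weight a q x k * f k))"
proof -
  have "Bseq (qpoch \<rho> q)"
    using qpoch_tendsto[OF q] by (intro convergent_imp_Bseq) (auto simp: convergent_def)
  then obtain B where B: "\<And>k. norm (qpoch \<rho> q k) \<le> B" "B > 0"
    by (auto simp: Bseq_def)
  have bound: "norm (bailey_weight a q x k * f k) \<le> norm x ^ k * (B * K)" for k
  proof -
    have "norm (bailey_weight a q x k * f k) = norm x ^ k * norm (q ^ (k choose 2)) * (norm (qpoch \<rho> q k) * norm (f k))"
      by (simp add: bailey_weight_eq[OF \<rho>] norm_mult norm_power)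
    also have "\<dots> \<le> norm x ^ k * (B * K)"
    proof (rule mult_mono)
      show "norm x ^ k * norm (q ^ (k choose 2)) \<le> norm x ^ k"
        by (intro mult_left_le norm_power_le_1 q) auto
      show "norm (qpoch \<rho> q k) * norm (f k) \<le> B * K"
        using B f by (intro mult_mono) auto
    qed auto
    finally show ?thesis .
  qed
  have g: "summable (\<lambda>k. norm x ^ k * (B * K))"
    using x by (intro summable_mult2 summable_geometric) simp
  show ?thesis
    by (rule summable_comparison_test'[OF g, of 0]) (simp add: bound)
qed


section \<open>Bailey pairs relative to 1 and to q\<close>

text \<open>
  In \<open>even_sum\<close> and \<open>odd_sum\<close> the function \<open>f\<close> stands for a bilateral sequence \<open>t\<close> folded into
  one over \<open>r \<ge> 0\<close>.  The denominators \<open>(q)_(n-r) (q)_(n+r)\<close> are invariant under \<open>r \<mapsto> -r\<close>, so there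
  \<open>f r = t r + t (-r)\<close> for \<open>r > 0\<close> and \<open>f 0 = t 0\<close>; the denominators \<open>(q)_(n-r) (q)_(n+r+1)\<close> are
  invariant under \<open>r \<mapsto> -r-1\<close>, so there \<open>f r = t r + t (-r-1)\<close>.
\<close>

definition even_sum :: "complex \<Rightarrow> (nat \<Rightarrow> complex) \<Rightarrow> nat \<Rightarrow> complex" where
  "even_sum q f n = (\<Sum>r\<le>n. f r / (qpoch q q (n - r) * qpoch q q (n + r)))"

definition odd_sum :: "complex \<Rightarrow> (nat \<Rightarrow> complex) \<Rightarrow> nat \<Rightarrow> complex" where
  "odd_sum q f n = (\<Sum>r\<le>n. f r / (qpoch q q (n - r) * qpoch q q (Suc (n + r))))"

lemma even_sum_cong: "(\<And>r. r \<le> n \<Longrightarrow> f r = g r) \<Longrightarrow> even_sum q f n = even_sum q g n"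
  by (simp add: even_sum_def)

lemma odd_sum_cong: "(\<And>r. r \<le> n \<Longrightarrow> f r = g r) \<Longrightarrow> odd_sum q f n = odd_sum q g n"
  by (simp add: odd_sum_def)

lemma even_sum_lincomb: "even_sum q f n - b * even_sum q g n = even_sum q (\<lambda>r. f r - b * g r) n"
  by (simp add: even_sum_def diff_divide_distrib sum_subtractf sum_distrib_left)

lemma odd_sum_lincomb: "odd_sum q f n - b * odd_sum q g n = odd_sum q (\<lambda>r. f r - b * g r) n"
  by (simp add: odd_sum_def diff_divide_distrib sum_subtractf sum_distrib_left)

lemma even_sum_scale: "even_sum q (\<lambda>r. b * f r) n = b * even_sum q f n"
  by (simp add: even_sum_def sum_distrib_left)

lemma odd_sum_scale: "odd_sum q (\<lambda>r. b * f r) n = b * odd_sum q f n"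
  by (simp add: odd_sum_def sum_distrib_left)

lemma qpoch_q_Suc: "qpoch q q (Suc n) = qpoch q q n * (1 - q ^ Suc n)"
  by (simp add: qpoch_Suc)

text \<open>
  Up to normalisation the two sums are those of Bailey pairs relative to \<open>1\<close> and to \<open>q\<close>.  With
  \<open>t' r = t (-r-1)\<close>, the lemma extends the denominator \<open>(q)_(n+r)\<close> of the bilateral sum to
  \<open>(q)_(n+r+1)\<close>.  The summands \<open>t r\<close> and \<open>t (-r)\<close> enter asymmetrically, so a folded sequence that
  can be split in two ways has two such expansions.
\<close>

lemma even_sum_eq_odd_sum:
  assumes q: "norm q < 1" and f: "f 0 = t 0" "\<And>r. f (Suc r) = t (Suc r) + t' r"
  shows "even_sum q f n = odd_sum q (\<lambda>r. t r * (1 - q ^ Suc (n + r)) + t' r * (1 - q ^ (n - r))) n"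
proof -
  let ?P = "qpoch q q"
  have nz: "1 - q ^ Suc k \<noteq> 0" for k
    by (rule one_minus_power_nonzero[OF q]) simp
  have "even_sum q f n = (\<Sum>r\<le>n. t r / (?P (n - r) * ?P (n + r)))
      + (\<Sum>r<n. t' r / (?P (n - Suc r) * ?P (n + Suc r)))"
    unfolding even_sum_def sum.atMost_shift by (simp add: f add_divide_distrib sum.distrib)
  also have "(\<Sum>r\<le>n. t r / (?P (n - r) * ?P (n + r)))
      = (\<Sum>r\<le>n. t r * (1 - q ^ Suc (n + r)) / (?P (n - r) * ?P (Suc (n + r))))"
    unfolding qpoch_q_Suc using nz by (simp del: power_Suc)
  also have "(\<Sum>r<n. t' r / (?P (n - Suc r) * ?P (n + Suc r)))
      = (\<Sum>r<n. t' r * (1 - q ^ (n - r)) / (?P (n - r) * ?P (Suc (n + r))))"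
  proof (intro sum.cong refl)
    fix r assume "r \<in> {..<n}"
    then have "n - r = Suc (n - Suc r)" by auto
    then show "t' r / (?P (n - Suc r) * ?P (n + Suc r))
      = t' r * (1 - q ^ (n - r)) / (?P (n - r) * ?P (Suc (n + r)))"
      using nz[of "n - Suc r"] by (simp add: qpoch_q_Suc[of q "n - Suc r"] del: power_Suc)
  qed
  also have "\<dots> = (\<Sum>r\<le>n. t' r * (1 - q ^ (n - r)) / (?P (n - r) * ?P (Suc (n + r))))"
    by (simp add: lessThan_Suc_atMost[symmetric])
  finally show ?thesis
    by (simp add: odd_sum_def sum.distrib[symmetric] add_divide_distrib[symmetric] del: power_Suc)
qed

text \<open>
  The opposite step: here \<open>(q)_(n-r)\<close> is extended to \<open>(q)_(n+1-r)\<close>, with \<open>s' r = s (-r-1)\<close>.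
\<close>

lemma odd_sum_eq_even_sum:
  assumes q: "norm q < 1" and f: "f 0 = s 0 * (1 - q ^ Suc n)"
    "\<And>r. f (Suc r) = s (Suc r) * (1 - q ^ (n - r)) + s' r * (1 - q ^ (n + r + 2))"
  shows "odd_sum q (\<lambda>r. s r + s' r) n = even_sum q f (Suc n)"
proof -
  let ?P = "qpoch q q"
  have nz: "1 - q ^ Suc k \<noteq> 0" for k
    by (rule one_minus_power_nonzero[OF q]) simp
  have "odd_sum q (\<lambda>r. s r + s' r) n = (\<Sum>r\<le>n. s r / (?P (n - r) * ?P (Suc (n + r))))
      + (\<Sum>r\<le>n. s' r / (?P (n - r) * ?P (Suc (n + r))))"
    by (simp add: odd_sum_def add_divide_distrib sum.distrib)
  also have "(\<Sum>r\<le>n. s r / (?P (n - r) * ?P (Suc (n + r))))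
      = (\<Sum>r\<le>n. s r * (1 - q ^ (Suc n - r)) / (?P (Suc n - r) * ?P (Suc n + r)))"
    using nz by (intro sum.cong refl) (simp add: Suc_diff_le qpoch_q_Suc[of q "n - _"] del: power_Suc)
  also have "\<dots> = (\<Sum>r\<le>Suc n. s r * (1 - q ^ (Suc n - r)) / (?P (Suc n - r) * ?P (Suc n + r)))"
    by simp
  also have "\<dots> = s 0 * (1 - q ^ Suc n) / (?P (Suc n) * ?P (Suc n))
      + (\<Sum>r\<le>n. s (Suc r) * (1 - q ^ (n - r)) / (?P (n - r) * ?P (Suc n + Suc r)))"
    by (subst sum.atMost_Suc_shift) simp
  also have "(\<Sum>r\<le>n. s' r / (?P (n - r) * ?P (Suc (n + r))))
      = (\<Sum>r\<le>n. s' r * (1 - q ^ (n + r + 2)) / (?P (n - r) * ?P (Suc n + Suc r)))"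
    using nz by (intro sum.cong refl) (simp add: qpoch_q_Suc[of q "Suc _"] del: power_Suc)
  finally show ?thesis
    unfolding even_sum_def sum.atMost_Suc_shift[of _ n]
    by (simp add: f add_divide_distrib sum.distrib del: power_Suc)
qed

lemma bailey_pair_1I: "(\<And>n. \<beta> n = even_sum q \<alpha> n) \<Longrightarrow> bailey_pair 1 q \<alpha> \<beta>"
  by (simp add: bailey_pair_def even_sum_def)

lemma bailey_pair_qI:
  assumes "norm q < 1" "\<And>n. \<beta> n = (1 - q) * odd_sum q \<alpha> n"
  shows "bailey_pair q q \<alpha> \<beta>"
proof -
  have "1 - q \<noteq> 0"
    using one_minus_power_nonzero[OF assms(1), of 1] by simp
  then show ?thesis
    by (simp add: bailey_pair_def odd_sum_def assms(2) qpoch_Suc_left sum_distrib_left mult_ac)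
qed

section \<open>The Jacobi triple product\<close>

text \<open>
  The terms of \<open>\<Sum>r. (-1)^r (x y)^(r choose 2) x^r\<close> over all integers \<open>r\<close>, folded along \<open>r \<mapsto> -r\<close>
  for \<open>theta_even\<close> and along \<open>r \<mapsto> -r-1\<close> for \<open>theta_odd\<close>.  The base \<open>x y\<close> makes negative powers of
  \<open>x\<close> into powers of \<open>y\<close>, so that no division occurs.
\<close>

definition theta_even :: "complex \<Rightarrow> complex \<Rightarrow> nat \<Rightarrow> complex" where
  "theta_even x y r = (if r = 0 then 1 else (-1) ^ r * (x * y) ^ (r choose 2) * (x ^ r + y ^ r))"

definition theta_odd :: "complex \<Rightarrow> complex \<Rightarrow> nat \<Rightarrow> complex" where
  "theta_odd x y r = (-1) ^ r * (x * y) ^ (r choose 2) * (x ^ r - (x * y) ^ r * y ^ Suc r)"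

text \<open>
  \<open>theta_even\<close> is symmetric in \<open>x\<close> and \<open>y\<close>, so it has two expansions by \<open>even_sum_eq_odd_sum\<close>.  The
  first minus \<open>y (x y)^n\<close> times the second is termwise a multiple of \<open>theta_odd\<close>.
\<close>

lemma theta_even_to_odd:
  assumes p: "norm (x * y) < 1"
  shows "even_sum (x * y) (theta_even x y) n * (1 - y * (x * y) ^ n)
           = (1 - (x * y) ^ (2 * n + 1)) * odd_sum (x * y) (theta_odd x y) n"
proof -
  define p where "p = x * y"
  define c where "c r = (-1) ^ r * p ^ (r choose 2)" for r
  have c: "c 0 = 1" "c (Suc r) = - c r * p ^ r" for r
    by (simp_all add: c_def choose_two_Suc power_add binomial_eq_0)
  have D: "even_sum p (theta_even x y) n = odd_sum p
      (\<lambda>r. c r * z ^ r * (1 - p ^ Suc (n + r)) + - c r * p ^ r * w ^ Suc r * (1 - p ^ (n - r))) n"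
    if "(z, w) = (x, y) \<or> (z, w) = (y, x)" for z w
  proof (rule even_sum_eq_odd_sum)
    have th: "theta_even x y (Suc r) = c (Suc r) * (x ^ Suc r + y ^ Suc r)" for r
      by (simp add: theta_even_def p_def[symmetric] c_def)
    show "theta_even x y (Suc r) = c (Suc r) * z ^ Suc r + - c r * p ^ r * w ^ Suc r" for r
      unfolding th c(2) using that by (auto simp: algebra_simps)
  qed (use p c in \<open>simp_all add: theta_even_def p_def\<close>)
  have "even_sum p (theta_even x y) n * (1 - y * p ^ n)
     = even_sum p (theta_even x y) n - y * p ^ n * even_sum p (theta_even x y) n"
    by (simp add: algebra_simps)
  also have "\<dots> = odd_sum p (\<lambda>r. c r * x ^ r * (1 - p ^ Suc (n + r)) + - c r * p ^ r * y ^ Suc r * (1 - p ^ (n - r))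
      - y * p ^ n * (c r * y ^ r * (1 - p ^ Suc (n + r)) + - c r * p ^ r * x ^ Suc r * (1 - p ^ (n - r)))) n"
    by (subst D[of x y], simp, subst D[of y x], simp, rule odd_sum_lincomb)
  also have "\<dots> = odd_sum p (\<lambda>r. (1 - p ^ (2 * n + 1)) * theta_odd x y r) n"
  proof (rule odd_sum_cong)
    fix r assume "r \<le> n"
    \<comment> \<open>A polynomial identity in \<open>R\<close>, \<open>N\<close>, \<open>x\<close>, \<open>y\<close>, \<open>x^r\<close>, \<open>y^r\<close> modulo \<open>p = x y\<close>.\<close>
    define R N where "R = p ^ r" and "N = p ^ (n - r)"
    have n: "p ^ n = N * R"
      using \<open>r \<le> n\<close> by (simp add: R_def N_def power_add[symmetric])
    have n': "p ^ Suc (n + r) = p * N * R * R" "p ^ (2 * n + 1) = p * (N * R) * (N * R)"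
      by (simp_all add: power_add n mult_2 R_def[symmetric])
    have *: "d * X * (1 - p * N * R * R) + - d * R * (y * Y) * (1 - N)
        - y * (N * R) * (d * Y * (1 - p * N * R * R) + - d * R * (x * X) * (1 - N))
        = (1 - p * (N * R) * (N * R)) * (d * (X - R * (y * Y)))" for d X Y
      using p_def by algebra
    show "c r * x ^ r * (1 - p ^ Suc (n + r)) + - c r * p ^ r * y ^ Suc r * (1 - p ^ (n - r))
      - y * p ^ n * (c r * y ^ r * (1 - p ^ Suc (n + r)) + - c r * p ^ r * x ^ Suc r * (1 - p ^ (n - r)))
      = (1 - p ^ (2 * n + 1)) * theta_odd x y r"
      unfolding theta_odd_def p_def[symmetric] c_def[symmetric] n n'
        R_def[symmetric] N_def[symmetric] power_Suc[of x] power_Suc[of y] by (rule *)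
  qed
  also have "\<dots> = (1 - p ^ (2 * n + 1)) * odd_sum p (theta_odd x y) n"
    by (rule odd_sum_scale)
  finally show ?thesis unfolding p_def .
qed

text \<open>
  The two summands of \<open>theta_odd\<close> can be given the roles of \<open>s\<close> and \<open>s'\<close> in \<open>odd_sum_eq_even_sum\<close>
  in either order; the two expansions are combined as before.
\<close>

lemma theta_odd_to_even:
  assumes p: "norm (x * y) < 1"
  shows "odd_sum (x * y) (theta_odd x y) n * (1 - x * (x * y) ^ n)
           = (1 - (x * y) ^ (2 * n + 2)) * even_sum (x * y) (theta_even x y) (Suc n)"
proof -
  define p where "p = x * y"
  define c where "c r = (-1) ^ r * p ^ (r choose 2)" for r
  have c: "c 0 = 1" "c (Suc r) = - c r * p ^ r" for r
    by (simp_all add: c_def choose_two_Suc power_add binomial_eq_0)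
  define f where "f r = (case r of 0 \<Rightarrow> 1 - p ^ Suc n
    | Suc r \<Rightarrow> c (Suc r) * x ^ Suc r * (1 - p ^ (n - r)) + - c r * p ^ r * y ^ Suc r * (1 - p ^ (n + r + 2)))" for r
  define g where "g r = (case r of 0 \<Rightarrow> - y * (1 - p ^ Suc n)
    | Suc r \<Rightarrow> - c (Suc r) * p ^ Suc r * y ^ Suc (Suc r) * (1 - p ^ (n - r)) + c r * x ^ r * (1 - p ^ (n + r + 2)))" for r
  have E1: "odd_sum p (theta_odd x y) n = even_sum p f (Suc n)"
  proof -
    have "odd_sum p (\<lambda>r. c r * x ^ r + - c r * p ^ r * y ^ Suc r) n = even_sum p f (Suc n)"
      by (rule odd_sum_eq_even_sum) (use p in \<open>simp_all add: f_def p_def[symmetric] c(1)\<close>)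
    then show ?thesis
      by (simp add: theta_odd_def p_def[symmetric] c_def[symmetric] algebra_simps cong: odd_sum_cong)
  qed
  have E2: "odd_sum p (theta_odd x y) n = even_sum p g (Suc n)"
  proof -
    have "odd_sum p (\<lambda>r. - c r * p ^ r * y ^ Suc r + c r * x ^ r) n = even_sum p g (Suc n)"
      by (rule odd_sum_eq_even_sum) (use p in \<open>simp_all add: g_def p_def[symmetric] c(1)\<close>)
    then show ?thesis
      by (simp add: theta_odd_def p_def[symmetric] c_def[symmetric] algebra_simps cong: odd_sum_cong)
  qed
  have "odd_sum p (theta_odd x y) n * (1 - x * p ^ n)
     = odd_sum p (theta_odd x y) n - x * p ^ n * odd_sum p (theta_odd x y) n"
    by (simp add: algebra_simps)
  also have "\<dots> = even_sum p f (Suc n) - x * p ^ n * even_sum p g (Suc n)"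
    by (simp only: E1[symmetric] E2[symmetric])
  also have "\<dots> = even_sum p (\<lambda>r. f r - x * p ^ n * g r) (Suc n)"
    by (rule even_sum_lincomb)
  also have "\<dots> = even_sum p (\<lambda>r. (1 - p ^ (2 * n + 2)) * theta_even x y r) (Suc n)"
  proof (rule even_sum_cong)
    fix r assume r: "r \<le> Suc n"
    show "f r - x * p ^ n * g r = (1 - p ^ (2 * n + 2)) * theta_even x y r"
    proof (cases r)
      case 0
      have "1 - p * P - x * P * (- y * (1 - p * P)) = 1 - p * P * (p * P)" for P
        using p_def by algebra
      moreover have "p ^ (2 * n + 2) = p * p ^ n * (p * p ^ n)"
        by (simp add: power_add mult_2 power2_eq_square)
      ultimately show ?thesis
        by (auto simp: 0 f_def g_def theta_even_def)
    next
      case (Suc k)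
      \<comment> \<open>A polynomial identity in \<open>R\<close>, \<open>N\<close>, \<open>x\<close>, \<open>y\<close>, \<open>x^k\<close>, \<open>y^k\<close> modulo \<open>p = x y\<close>.\<close>
      define R N where "R = p ^ k" and "N = p ^ (n - k)"
      have n: "p ^ n = N * R"
        using r Suc by (simp add: R_def N_def power_add[symmetric])
      have n': "p ^ (n + k + 2) = N * R * R * (p * p)" "p ^ (2 * n + 2) = N * R * (N * R) * (p * p)"
        by (simp_all add: power_add n mult_2 R_def[symmetric] power2_eq_square)
      have *: "- d * R * (x * X) * (1 - N) + - d * R * (y * Y) * (1 - N * R * R * (p * p))
          - x * (N * R) * (- (- d * R) * (p * R) * (y * (y * Y)) * (1 - N) + d * X * (1 - N * R * R * (p * p)))
          = (1 - N * R * (N * R) * (p * p)) * (- d * R * (x * X + y * Y))" for d X Y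
        using p_def by algebra
      have th: "theta_even x y (Suc k) = c (Suc k) * (x ^ Suc k + y ^ Suc k)"
        by (simp add: theta_even_def p_def[symmetric] c_def)
      show ?thesis
        unfolding Suc th f_def g_def nat.case n n' c(2) R_def[symmetric] N_def[symmetric] power_Suc
        by (rule *)
    qed
  qed
  also have "\<dots> = (1 - p ^ (2 * n + 2)) * even_sum p (theta_even x y) (Suc n)"
    by (rule even_sum_scale)
  finally show ?thesis unfolding p_def .
qed

text \<open>
  In the language of Gaussian binomials the first formula says
  \<open>\<Sum>r. (-1)^r p^(r choose 2) x^r [2n, n+r] = (x;p)_n (y;p)_n\<close> with \<open>p = x y\<close>.
\<close>

lemma finite_jacobi_triple_product:
  assumes p: "norm (x * y) < 1"
  shows "even_sum (x * y) (theta_even x y) n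
           = qpoch x (x * y) n * qpoch y (x * y) n / qpoch (x * y) (x * y) (2 * n)"
    and "odd_sum (x * y) (theta_odd x y) n
           = qpoch x (x * y) n * qpoch y (x * y) (Suc n) / qpoch (x * y) (x * y) (Suc (2 * n))"
proof -
  let ?p = "x * y"
  have nz: "1 - ?p ^ Suc k \<noteq> 0" for k
    by (rule one_minus_power_nonzero[OF p]) simp
  have odd: "odd_sum ?p (theta_odd x y) n
           = qpoch x ?p n * qpoch y ?p (Suc n) / qpoch ?p ?p (Suc (2 * n))"
    if "even_sum ?p (theta_even x y) n = qpoch x ?p n * qpoch y ?p n / qpoch ?p ?p (2 * n)" for n
  proof -
    have "odd_sum ?p (theta_odd x y) n = even_sum ?p (theta_even x y) n * (1 - y * ?p ^ n) / (1 - ?p ^ Suc (2 * n))"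
      using theta_even_to_odd[OF p, of n] nz[of "2 * n"] by (simp del: power_Suc)
    then show ?thesis
      unfolding that qpoch_q_Suc qpoch_Suc[of y] by (simp del: power_Suc)
  qed
  show even: "even_sum ?p (theta_even x y) n = qpoch x ?p n * qpoch y ?p n / qpoch ?p ?p (2 * n)" for n
  proof (induction n)
    case (Suc n)
    have "even_sum ?p (theta_even x y) (Suc n)
        = odd_sum ?p (theta_odd x y) n * (1 - x * ?p ^ n) / (1 - ?p ^ Suc (Suc (2 * n)))"
      using theta_odd_to_even[OF p, of n] nz[of "Suc (2 * n)"] by (simp del: power_Suc)
    moreover have "qpoch ?p ?p (2 * Suc n) = qpoch ?p ?p (Suc (2 * n)) * (1 - ?p ^ Suc (Suc (2 * n)))"
      using qpoch_q_Suc[of ?p "Suc (2 * n)"] by simp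
    ultimately show ?case
      unfolding odd[OF Suc] qpoch_Suc[of x] by (simp del: power_Suc)
  qed (simp add: even_sum_def theta_even_def)
  show "odd_sum ?p (theta_odd x y) n
           = qpoch x ?p n * qpoch y ?p (Suc n) / qpoch ?p ?p (Suc (2 * n))"
    by (rule odd[OF even])
qed

lemma summable_norm_theta:
  assumes x: "norm x < 1" and y: "norm y < 1"
  shows "summable (\<lambda>r. norm (theta_even x y r))" "summable (\<lambda>r. norm (theta_odd x y r))"
proof -
  have g: "summable (\<lambda>r. norm x ^ r + norm y ^ r)"
    using x y by (intro summable_add summable_geometric) auto
  have p: "norm (x * y) < 1"
    using norm_mult_power_less_1[OF x y, of 1] by simp
  have c: "norm ((-1) ^ r * (x * y) ^ (r choose 2)) \<le> 1" for r
    using norm_power_le_1[OF p] by (simp add: norm_mult norm_power)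
  show "summable (\<lambda>r. norm (theta_even x y r))"
  proof (rule summable_comparison_test'[OF g, of 0])
    fix r
    have "norm ((-1) ^ r * (x * y) ^ (r choose 2)) * norm (x ^ r + y ^ r) \<le> 1 * (norm x ^ r + norm y ^ r)"
      using norm_triangle_ineq[of "x ^ r" "y ^ r"] by (intro mult_mono c) (auto simp: norm_power)
    then show "norm (norm (theta_even x y r)) \<le> norm x ^ r + norm y ^ r"
      by (cases "r = 0") (simp_all add: theta_even_def norm_mult)
  qed
  show "summable (\<lambda>r. norm (theta_odd x y r))"
  proof (rule summable_comparison_test'[OF g, of 0])
    fix r
    have "norm ((x * y) ^ r * y) * norm (y ^ r) \<le> norm (y ^ r)"
      using norm_power_le_1[OF p, of r] y unfolding norm_mult
      by (intro mult_left_le_one_le mult_le_one) auto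
    then have "norm (x ^ r - (x * y) ^ r * y ^ Suc r) \<le> norm x ^ r + norm y ^ r"
      using norm_triangle_ineq4[of "x ^ r" "(x * y) ^ r * y ^ Suc r"]
      by (simp add: norm_mult norm_power mult_ac)
    then have "norm ((-1) ^ r * (x * y) ^ (r choose 2)) * norm (x ^ r - (x * y) ^ r * y ^ Suc r)
        \<le> 1 * (norm x ^ r + norm y ^ r)"
      by (intro mult_mono c) auto
    then show "norm (norm (theta_odd x y r)) \<le> norm x ^ r + norm y ^ r"
      by (simp add: theta_odd_def norm_mult)
  qed
qed

text \<open>
  The limit \<open>n \<rightarrow> \<infinity>\<close> of the finite form.  The version for \<open>theta_odd\<close> sums the same bilateral series
  with its terms paired differently.
\<close>

theorem jacobi_triple_product_even:
  assumes x: "norm x < 1" and y: "norm y < 1"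
  shows "theta_even x y sums
           (qpoch_inf x (x * y) * qpoch_inf y (x * y) * qpoch_inf (x * y) (x * y))"
proof -
  let ?p = "x * y"
  have p: "norm ?p < 1"
    using norm_mult_power_less_1[OF x y, of 1] by simp
  have nz: "qpoch_inf ?p ?p \<noteq> 0"
    by (rule qpoch_inf_nonzero[OF p p])
  have "(\<lambda>n. qpoch ?p ?p (2 * n)) \<longlonglongrightarrow> qpoch_inf ?p ?p"
    using LIMSEQ_subseq_LIMSEQ[OF qpoch_tendsto[OF p, of ?p], of "\<lambda>n. 2 * n"]
    by (simp add: strict_mono_def o_def)
  then have "(\<lambda>n. qpoch x ?p n * qpoch y ?p n / qpoch ?p ?p (2 * n))
      \<longlonglongrightarrow> qpoch_inf x ?p * qpoch_inf y ?p / qpoch_inf ?p ?p"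
    using nz by (intro tendsto_intros qpoch_tendsto p)
  then have "theta_even x y sums (qpoch_inf x ?p * qpoch_inf y ?p / qpoch_inf ?p ?p
      * (qpoch_inf ?p ?p * qpoch_inf (1 * ?p) ?p))"
    using p by (intro bailey_pair_limit[where \<beta> = "\<lambda>n. qpoch x ?p n * qpoch y ?p n / qpoch ?p ?p (2 * n)"]
        bailey_pair_1I summable_norm_theta x y) (simp_all add: finite_jacobi_triple_product)
  then show ?thesis using nz by (simp add: mult_ac)
qed

theorem jacobi_triple_product_odd:
  assumes x: "norm x < 1" and y: "norm y < 1"
  shows "theta_odd x y sums
           (qpoch_inf x (x * y) * qpoch_inf y (x * y) * qpoch_inf (x * y) (x * y))"
proof -
  let ?p = "x * y"
  let ?\<beta> = "\<lambda>n. (1 - ?p) * (qpoch x ?p n * qpoch y ?p (Suc n) / qpoch ?p ?p (Suc (2 * n)))"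
  have p: "norm ?p < 1"
    using norm_mult_power_less_1[OF x y, of 1] by simp
  have nz: "qpoch_inf ?p ?p \<noteq> 0"
    by (rule qpoch_inf_nonzero[OF p p])
  have "(\<lambda>n. qpoch ?p ?p (Suc (2 * n))) \<longlonglongrightarrow> qpoch_inf ?p ?p"
    using LIMSEQ_subseq_LIMSEQ[OF qpoch_tendsto[OF p, of ?p], of "\<lambda>n. Suc (2 * n)"]
    by (simp add: strict_mono_def o_def)
  moreover have "(\<lambda>n. qpoch y ?p (Suc n)) \<longlonglongrightarrow> qpoch_inf y ?p"
    by (intro LIMSEQ_Suc qpoch_tendsto p)
  ultimately have "?\<beta> \<longlonglongrightarrow> (1 - ?p) * (qpoch_inf x ?p * qpoch_inf y ?p / qpoch_inf ?p ?p)"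
    using nz by (intro tendsto_intros qpoch_tendsto p)
  then have "theta_odd x y sums ((1 - ?p) * (qpoch_inf x ?p * qpoch_inf y ?p / qpoch_inf ?p ?p)
      * (qpoch_inf ?p ?p * qpoch_inf (?p * ?p) ?p))"
    using p norm_mult_power_less_1[OF p p, of 1]
    by (intro bailey_pair_limit[where \<beta> = ?\<beta>] bailey_pair_qI summable_norm_theta x y)
       (simp_all add: finite_jacobi_triple_product)
  moreover have "qpoch_inf ?p ?p = (1 - ?p) * qpoch_inf (?p * ?p) ?p"
    using qpoch_inf_split[OF p, of ?p 1] by (simp add: qpoch_Suc)
  ultimately show ?thesis using nz by (simp add: mult_ac)
qed

section \<open>The quadratic form of the triple sums\<close>

lemma triple_sum_exponent:
  "Suc w * i + 2 * ((i choose 2) + i * (j + k)) + (2 * s * (j + k) + 2 * (j + k)\<^sup>2)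
      + (Suc w * k + 2 * (k choose 2) + t * k)
    = i\<^sup>2 + 2 * j\<^sup>2 + 3 * k\<^sup>2 + 2 * i * j + 2 * i * k + 4 * j * k
      + w * i + 2 * s * j + (2 * s + w + t) * k"
proof -
  have "Suc w * i + 2 * (ci + i * (j + k)) + (2 * s * (j + k) + 2 * (j + k)\<^sup>2)
          + (Suc w * k + 2 * ck + t * k)
        = (2 * ci + i) + 2 * j\<^sup>2 + (2 * ck + k + 2 * k\<^sup>2) + 2 * i * j + 2 * i * k + 4 * j * k
          + w * i + 2 * s * j + (2 * s + w + t) * k" for ci ck
    unfolding power2_sum by (simp only: mult_Suc algebra_simps) simp
  from this[of "i choose 2" "k choose 2"] show ?thesis
    using square_eq_choose_two[of i] square_eq_choose_two[of k] by linarith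
qed

text \<open>
  Here \<open>bailey_triple_sum\<close> is used with base \<open>q\<^sup>2\<close>, \<open>a = q^(2s)\<close>, \<open>x = -q^(w+1)\<close> and \<open>\<rho> = -q^v\<close>.  The
  condition on \<open>w\<close>, \<open>v\<close> and \<open>s\<close> is \<open>a Q = x \<rho>\<close>; the factor \<open>(\<rho>;Q)_k\<close> of the weight then cancels against
  the one in \<open>\<beta>\<close>.
\<close>

lemma triple_sum_of_bailey_pair:
  assumes q: "norm q < 1" and uv: "w + v = 2 * s + 1" "v > 0"
    and bp: "bailey_pair (q ^ (2 * s)) (q\<^sup>2) \<alpha>
      (\<lambda>k. q ^ (t * k) / (qpoch (- (q ^ v)) (q\<^sup>2) k * qpoch (q ^ 4) (q ^ 4) k))"
    and \<alpha>: "\<And>r. norm (\<alpha> r) \<le> K"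
    and T: "(\<lambda>r. q ^ (2 * s * r) * (q\<^sup>2) ^ (r\<^sup>2) * q ^ (Suc w * r) * (q\<^sup>2) ^ (r choose 2)
      * (qpoch (- (q ^ v)) (q\<^sup>2) r * qpoch_inf (- (q ^ Suc w) * (q\<^sup>2) ^ r) (q\<^sup>2)) * \<alpha> r) sums T"
  shows "((\<lambda>(i, j, k). q ^ (i\<^sup>2 + 2 * j\<^sup>2 + 3 * k\<^sup>2 + 2 * i * j + 2 * i * k + 4 * j * k
              + w * i + 2 * s * j + (2 * s + w + t) * k)
            / (qpoch (q\<^sup>2) (q\<^sup>2) i * qpoch (q\<^sup>2) (q\<^sup>2) j * qpoch (q ^ 4) (q ^ 4) k))
          has_sum (T / qpoch_inf (q ^ (2 * s + 2)) (q\<^sup>2))) (UNIV :: (nat \<times> nat \<times> nat) set)"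
proof -
  let ?x = "- (q ^ Suc w)" and ?a = "q ^ (2 * s)" and ?\<rho> = "- (q ^ v)"
  let ?\<beta> = "\<lambda>k. q ^ (t * k) / (qpoch ?\<rho> (q\<^sup>2) k * qpoch (q ^ 4) (q ^ 4) k)"
  have less: "norm (q ^ n) < 1" if "n > 0" for n
    using q that by (simp add: norm_power power_less_one_iff)
  have Q: "norm (q\<^sup>2) < 1" and q4: "norm (q ^ 4) < 1" and x: "norm ?x < 1" and \<rho>: "norm ?\<rho> < 1"
    using less[of 2] less[of 4] less[of "Suc w"] less[of v] uv by simp_all
  have a: "norm ?a \<le> 1"
    by (rule norm_power_le_1[OF q])
  have a\<rho>: "?a * q\<^sup>2 = ?x * ?\<rho>"
  proof -
    have "2 * s + 2 = Suc w + v" using uv by simp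
    then have "q ^ (2 * s + 2) = q ^ (Suc w + v)" by simp
    then show ?thesis by (simp only: power_add minus_mult_minus)
  qed
  have W: "bailey_weight ?a (q\<^sup>2) ?x k = q ^ (Suc w * k) * (q\<^sup>2) ^ (k choose 2) * qpoch ?\<rho> (q\<^sup>2) k" for k
    by (simp only: bailey_weight_eq[OF a\<rho>] minus_minus power_mult[of q "Suc w"])
  have \<rho>_nz: "qpoch ?\<rho> (q\<^sup>2) k \<noteq> 0" for k
    by (rule qpoch_nonzero[OF \<rho> Q])
  obtain B where B: "\<And>n. norm (1 / qpoch ?\<rho> (q\<^sup>2) n) \<le> B" "B > 0"
    using inverse_qpoch_bounded[OF \<rho> Q] by blast
  obtain C where C: "\<And>n. norm (1 / qpoch (q ^ 4) (q ^ 4) n) \<le> C" "C > 0"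
    using inverse_qpoch_bounded[OF q4 q4] by blast
  have \<beta>: "norm (?\<beta> k) \<le> 1 * (B * C)" for k
  proof -
    have "norm (q ^ (t * k)) * (norm (1 / qpoch ?\<rho> (q\<^sup>2) k) * norm (1 / qpoch (q ^ 4) (q ^ 4) k)) \<le> 1 * (B * C)"
      using B C by (intro mult_mono norm_power_le_1 q) auto
    then show ?thesis by (simp add: norm_mult norm_divide)
  qed
  have "((\<lambda>(i, j, k). (- ?x) ^ i * (q\<^sup>2) ^ ((i choose 2) + i * (j + k)) * (?a ^ (j + k) * (q\<^sup>2) ^ ((j + k)\<^sup>2))
              * (bailey_weight ?a (q\<^sup>2) ?x k * ?\<beta> k) / (qpoch (q\<^sup>2) (q\<^sup>2) i * qpoch (q\<^sup>2) (q\<^sup>2) j))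
          has_sum (T / qpoch_inf (?a * q\<^sup>2) (q\<^sup>2))) (UNIV :: (nat \<times> nat \<times> nat) set)"
  proof (rule bailey_triple_sum[OF Q a x bp])
    show "summable (\<lambda>r. norm (bailey_weight ?a (q\<^sup>2) ?x r * \<alpha> r))"
      by (rule summable_bailey_weight[OF Q x a\<rho> \<alpha>])
    show "summable (\<lambda>k. norm (bailey_weight ?a (q\<^sup>2) ?x k * ?\<beta> k))"
      by (rule summable_bailey_weight[OF Q x a\<rho> \<beta>])
    show "(\<lambda>r. ?a ^ r * (q\<^sup>2) ^ r\<^sup>2 * (bailey_weight ?a (q\<^sup>2) ?x r * \<alpha> r * qpoch_inf (?x * (q\<^sup>2) ^ r) (q\<^sup>2))) sums T"
    proof -
      have a: "?a ^ r = q ^ (2 * s * r)" for r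
        by (simp only: power_mult)
      have "?a ^ r * (q\<^sup>2) ^ r\<^sup>2 * (bailey_weight ?a (q\<^sup>2) ?x r * \<alpha> r * qpoch_inf (?x * (q\<^sup>2) ^ r) (q\<^sup>2))
          = q ^ (2 * s * r) * (q\<^sup>2) ^ (r\<^sup>2) * q ^ (Suc w * r) * (q\<^sup>2) ^ (r choose 2)
            * (qpoch ?\<rho> (q\<^sup>2) r * qpoch_inf (?x * (q\<^sup>2) ^ r) (q\<^sup>2)) * \<alpha> r" for r
        unfolding W a by (simp only: mult_ac)
      then show ?thesis
        using T by (simp only:)
    qed
  qed
  also have "?a * q\<^sup>2 = q ^ (2 * s + 2)"
    by (simp only: power_add)
  also have "(\<lambda>(i, j, k). (- ?x) ^ i * (q\<^sup>2) ^ ((i choose 2) + i * (j + k)) * (?a ^ (j + k) * (q\<^sup>2) ^ ((j + k)\<^sup>2))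
              * (bailey_weight ?a (q\<^sup>2) ?x k * ?\<beta> k) / (qpoch (q\<^sup>2) (q\<^sup>2) i * qpoch (q\<^sup>2) (q\<^sup>2) j))
    = (\<lambda>(i, j, k). q ^ (i\<^sup>2 + 2 * j\<^sup>2 + 3 * k\<^sup>2 + 2 * i * j + 2 * i * k + 4 * j * k
              + w * i + 2 * s * j + (2 * s + w + t) * k)
            / (qpoch (q\<^sup>2) (q\<^sup>2) i * qpoch (q\<^sup>2) (q\<^sup>2) j * qpoch (q ^ 4) (q ^ 4) k))"
  proof (intro ext, clarify)
    have cancel: "X * (Y * R * (Z / (R * F))) / P = X * (Y * Z) / (P * F)" if "R \<noteq> 0"
      for F P R X Y Z :: complex
      using that by simp
    fix i j k :: nat
    have "(- ?x) ^ i * (q\<^sup>2) ^ ((i choose 2) + i * (j + k)) * (?a ^ (j + k) * (q\<^sup>2) ^ ((j + k)\<^sup>2))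
        * (q ^ (Suc w * k) * (q\<^sup>2) ^ (k choose 2) * q ^ (t * k))
      = q ^ (Suc w * i + 2 * ((i choose 2) + i * (j + k)) + (2 * s * (j + k) + 2 * (j + k)\<^sup>2)
          + (Suc w * k + 2 * (k choose 2) + t * k))"
      by (simp only: minus_minus power_mult[symmetric] power_add[symmetric])
    also have "Suc w * i + 2 * ((i choose 2) + i * (j + k)) + (2 * s * (j + k) + 2 * (j + k)\<^sup>2)
          + (Suc w * k + 2 * (k choose 2) + t * k)
        = i\<^sup>2 + 2 * j\<^sup>2 + 3 * k\<^sup>2 + 2 * i * j + 2 * i * k + 4 * j * k
              + w * i + 2 * s * j + (2 * s + w + t) * k"
      by (rule triple_sum_exponent)
    finally have e: "(- ?x) ^ i * (q\<^sup>2) ^ ((i choose 2) + i * (j + k)) * (?a ^ (j + k) * (q\<^sup>2) ^ ((j + k)\<^sup>2))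
        * (q ^ (Suc w * k) * (q\<^sup>2) ^ (k choose 2) * q ^ (t * k))
      = q ^ (i\<^sup>2 + 2 * j\<^sup>2 + 3 * k\<^sup>2 + 2 * i * j + 2 * i * k + 4 * j * k
              + w * i + 2 * s * j + (2 * s + w + t) * k)" .
    show "(- ?x) ^ i * (q\<^sup>2) ^ ((i choose 2) + i * (j + k)) * (?a ^ (j + k) * (q\<^sup>2) ^ ((j + k)\<^sup>2))
              * (bailey_weight ?a (q\<^sup>2) ?x k * ?\<beta> k) / (qpoch (q\<^sup>2) (q\<^sup>2) i * qpoch (q\<^sup>2) (q\<^sup>2) j)
      = q ^ (i\<^sup>2 + 2 * j\<^sup>2 + 3 * k\<^sup>2 + 2 * i * j + 2 * i * k + 4 * j * k
              + w * i + 2 * s * j + (2 * s + w + t) * k)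
            / (qpoch (q\<^sup>2) (q\<^sup>2) i * qpoch (q\<^sup>2) (q\<^sup>2) j * qpoch (q ^ 4) (q ^ 4) k)"
      unfolding e[symmetric] W by (rule cancel[OF \<rho>_nz])
  qed
  finally show ?thesis .
qed

section \<open>Slater's Bailey pairs\<close>

text \<open>
  The sequences \<open>\<alpha>\<close> of Slater's pairs with base \<open>q\<^sup>2\<close>, up to constant factors: \<open>slater1\<close> and
  \<open>slater2\<close> relative to \<open>1\<close>, \<open>slater3\<close> and \<open>slater4\<close> relative to \<open>q\<^sup>2\<close>.
\<close>

definition slater1 :: "complex \<Rightarrow> nat \<Rightarrow> complex" where
  "slater1 q r = (if r = 0 then 1 else (-1) ^ r * q ^ (3 * (r choose 2)) * q ^ r * (1 + q ^ r))"

definition slater2 :: "complex \<Rightarrow> nat \<Rightarrow> complex" where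
  "slater2 q r = (if r = 0 then 1 else (-1) ^ r * q ^ (3 * (r choose 2)) * (1 + (q ^ r) ^ 3))"

definition slater3 :: "complex \<Rightarrow> nat \<Rightarrow> complex" where
  "slater3 q r = (-1) ^ r * q ^ (3 * (r choose 2)) * (q ^ r)\<^sup>2 * (1 - q * (q ^ r)\<^sup>2)"

definition slater4 :: "complex \<Rightarrow> nat \<Rightarrow> complex" where
  "slater4 q r = (-1) ^ r * q ^ (3 * (r choose 2)) * q ^ r * (1 - q\<^sup>2 * (q ^ r) ^ 4)"

context
  fixes q :: complex
  assumes q: "norm q < 1"
begin

lemma norm_power2_less_1: "norm (q\<^sup>2) < 1"
  using q by (simp add: norm_power power_less_one_iff)

lemma slater_coeff_Suc:
  "(-1) ^ Suc r * q ^ (3 * (Suc r choose 2)) = - ((-1) ^ r * q ^ (3 * (r choose 2))) * (q ^ r) ^ 3"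
  by (simp add: choose_two_Suc distrib_left power_add mult.commute[of 3] power_mult)

lemma square_base_powers:
  assumes "r \<le> n"
  shows "(q\<^sup>2) ^ Suc (n + r) = q\<^sup>2 * (q ^ (n - r))\<^sup>2 * (q ^ r) ^ 4" "(q\<^sup>2) ^ (n - r) = (q ^ (n - r))\<^sup>2"
    "(q\<^sup>2) ^ (n + r + 2) = q ^ 4 * (q ^ (n - r))\<^sup>2 * (q ^ r) ^ 4"
    "q ^ (2 * n + 1) = q * (q ^ (n - r))\<^sup>2 * (q ^ r)\<^sup>2"
    "q ^ (2 * n) = (q ^ (n - r))\<^sup>2 * (q ^ r)\<^sup>2"
    "q ^ (2 * n + 2) = q\<^sup>2 * (q ^ (n - r))\<^sup>2 * (q ^ r)\<^sup>2"
proof -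
  obtain m where n: "n = m + r"
    using assms by (metis add.commute le_Suc_ex)
  show "(q\<^sup>2) ^ Suc (n + r) = q\<^sup>2 * (q ^ (n - r))\<^sup>2 * (q ^ r) ^ 4" "(q\<^sup>2) ^ (n - r) = (q ^ (n - r))\<^sup>2"
    "(q\<^sup>2) ^ (n + r + 2) = q ^ 4 * (q ^ (n - r))\<^sup>2 * (q ^ r) ^ 4"
    "q ^ (2 * n + 1) = q * (q ^ (n - r))\<^sup>2 * (q ^ r)\<^sup>2"
    "q ^ (2 * n) = (q ^ (n - r))\<^sup>2 * (q ^ r)\<^sup>2"
    "q ^ (2 * n + 2) = q\<^sup>2 * (q ^ (n - r))\<^sup>2 * (q ^ r)\<^sup>2"
    by (simp_all add: n power_mult[symmetric] power_add[symmetric] power_Suc[symmetric]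
               del: power_Suc add_2_eq_Suc')
       (simp_all add: algebra_simps del: power_Suc)
qed

text \<open>
  This lemma and the next two expand \<open>slater1\<close>, in both possible ways, and \<open>slater2\<close> by
  \<open>even_sum_eq_odd_sum\<close>; each time the result agrees termwise with a multiple of the right-hand side.
\<close>

lemma slater1_eq_slater3:
  "even_sum (q\<^sup>2) (slater1 q) n = (1 + q ^ (2 * n + 1)) * odd_sum (q\<^sup>2) (slater3 q) n"
proof -
  let ?c = "\<lambda>r. (-1) ^ r * q ^ (3 * (r choose 2))"
  have "even_sum (q\<^sup>2) (slater1 q) n = odd_sum (q\<^sup>2) (\<lambda>r. ?c r * (q ^ r)\<^sup>2 * (1 - (q\<^sup>2) ^ Suc (n + r))
      + - ?c r * q * (q ^ r) ^ 4 * (1 - (q\<^sup>2) ^ (n - r))) n"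
  proof (rule even_sum_eq_odd_sum[OF norm_power2_less_1])
    show "slater1 q (Suc r) = ?c (Suc r) * (q ^ Suc r)\<^sup>2 + - ?c r * q * (q ^ r) ^ 4" for r
      unfolding slater1_def slater_coeff_Suc power_Suc[of q] by simp algebra
  qed (simp add: slater1_def)
  also have "\<dots> = odd_sum (q\<^sup>2) (\<lambda>r. (1 + q ^ (2 * n + 1)) * slater3 q r) n"
    by (rule odd_sum_cong) (unfold slater3_def, simp only: square_base_powers, algebra)
  finally show ?thesis by (simp add: odd_sum_scale)
qed

lemma slater1_eq_slater4: "even_sum (q\<^sup>2) (slater1 q) n = odd_sum (q\<^sup>2) (slater4 q) n"
proof -
  let ?c = "\<lambda>r. (-1) ^ r * q ^ (3 * (r choose 2))"
  have "even_sum (q\<^sup>2) (slater1 q) n = odd_sum (q\<^sup>2) (\<lambda>r. ?c r * q ^ r * (1 - (q\<^sup>2) ^ Suc (n + r))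
      + - ?c r * q\<^sup>2 * (q ^ r) ^ 5 * (1 - (q\<^sup>2) ^ (n - r))) n"
  proof (rule even_sum_eq_odd_sum[OF norm_power2_less_1])
    show "slater1 q (Suc r) = ?c (Suc r) * q ^ Suc r + - ?c r * q\<^sup>2 * (q ^ r) ^ 5" for r
      unfolding slater1_def slater_coeff_Suc power_Suc[of q] by simp algebra
  qed (simp add: slater1_def)
  also have "\<dots> = odd_sum (q\<^sup>2) (slater4 q) n"
    by (rule odd_sum_cong) (unfold slater4_def, simp only: square_base_powers, algebra)
  finally show ?thesis .
qed

lemma slater2_eq_slater4: "even_sum (q\<^sup>2) (slater2 q) n = q ^ (2 * n) * odd_sum (q\<^sup>2) (slater4 q) n"
proof -
  let ?c = "\<lambda>r. (-1) ^ r * q ^ (3 * (r choose 2))"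
  have "even_sum (q\<^sup>2) (slater2 q) n = odd_sum (q\<^sup>2) (\<lambda>r. ?c r * (q ^ r) ^ 3 * (1 - (q\<^sup>2) ^ Suc (n + r))
      + - ?c r * (q ^ r) ^ 3 * (1 - (q\<^sup>2) ^ (n - r))) n"
  proof (rule even_sum_eq_odd_sum[OF norm_power2_less_1])
    show "slater2 q (Suc r) = ?c (Suc r) * (q ^ Suc r) ^ 3 + - ?c r * (q ^ r) ^ 3" for r
      unfolding slater2_def slater_coeff_Suc power_Suc[of q] by simp algebra
  qed (simp add: slater2_def)
  also have "\<dots> = odd_sum (q\<^sup>2) (\<lambda>r. q ^ (2 * n) * slater4 q r) n"
    by (rule odd_sum_cong) (unfold slater4_def, simp only: square_base_powers, algebra)
  finally show ?thesis by (simp add: odd_sum_scale)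
qed

text \<open>
  Together with the preceding three relations this closes a first-order recurrence in \<open>n\<close> for the
  sums of \<open>slater1\<close>.
\<close>

lemma slater3_eq_slater1_slater2:
  "odd_sum (q\<^sup>2) (slater3 q) n =
     even_sum (q\<^sup>2) (slater1 q) (Suc n) - q ^ (2 * n + 2) * even_sum (q\<^sup>2) (slater2 q) (Suc n)"
proof -
  let ?c = "\<lambda>r. (-1) ^ r * q ^ (3 * (r choose 2))"
  define f where "f r = (case r of 0 \<Rightarrow> 1 - (q\<^sup>2) ^ Suc n
    | Suc r \<Rightarrow> ?c (Suc r) * (q ^ Suc r)\<^sup>2 * (1 - (q\<^sup>2) ^ (n - r))
        + - ?c r * q * (q ^ r) ^ 4 * (1 - (q\<^sup>2) ^ (n + r + 2)))" for r
  have "odd_sum (q\<^sup>2) (slater3 q) n = odd_sum (q\<^sup>2) (\<lambda>r. ?c r * (q ^ r)\<^sup>2 + - ?c r * q * (q ^ r) ^ 4) n"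
    by (rule odd_sum_cong) (unfold slater3_def, algebra)
  also have "\<dots> = even_sum (q\<^sup>2) f (Suc n)"
    by (rule odd_sum_eq_even_sum[OF norm_power2_less_1]) (simp_all add: f_def)
  also have "\<dots> = even_sum (q\<^sup>2) (\<lambda>r. slater1 q r - q ^ (2 * n + 2) * slater2 q r) (Suc n)"
  proof (rule even_sum_cong)
    fix r assume r: "r \<le> Suc n"
    show "f r = slater1 q r - q ^ (2 * n + 2) * slater2 q r"
    proof (cases r)
      case 0
      then show ?thesis
        by (simp add: f_def slater1_def slater2_def power_mult power2_eq_square power_mult_distrib)
    next
      case (Suc k)
      then have "k \<le> n" using r by simp
      have f: "f (Suc k) = ?c (Suc k) * (q ^ Suc k)\<^sup>2 * (1 - (q\<^sup>2) ^ (n - k))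
        + - ?c k * q * (q ^ k) ^ 4 * (1 - (q\<^sup>2) ^ (n + k + 2))"
        by (simp add: f_def)
      have s: "slater1 q (Suc k) = ?c (Suc k) * q ^ Suc k * (1 + q ^ Suc k)"
        "slater2 q (Suc k) = ?c (Suc k) * (1 + (q ^ Suc k) ^ 3)"
        by (simp_all only: slater1_def slater2_def nat.simps if_False)
      show ?thesis
        unfolding Suc f s slater_coeff_Suc power_Suc[of q] square_base_powers[OF \<open>k \<le> n\<close>] by algebra
    qed
  qed
  finally show ?thesis by (simp only: even_sum_lincomb)
qed

text \<open>
  Eliminating the sums of the other three sequences leaves
  \<open>A_(n+1) (1 - q^(4n+4)) (1 + q^(2n+1)) = A_n\<close> for the sums \<open>A_n\<close> of \<open>slater1\<close>.
\<close>

lemma slater1_sum: "even_sum (q\<^sup>2) (slater1 q) n = 1 / (qpoch (- q) (q\<^sup>2) n * qpoch (q ^ 4) (q ^ 4) n)"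
proof (induction n)
  case (Suc n)
  have nz: "1 + q ^ (2 * n + 1) \<noteq> 0" "1 - q ^ (4 * n + 4) \<noteq> 0"
  proof -
    have "norm (q ^ (2 * n + 1)) < 1"
      using norm_mult_power_less_1[OF q q, of "2 * n"] by simp
    then show "1 + q ^ (2 * n + 1) \<noteq> 0"
      by (metis add_eq_0_iff less_irrefl norm_minus_cancel norm_one)
    show "1 - q ^ (4 * n + 4) \<noteq> 0"
      by (rule one_minus_power_nonzero[OF q]) simp
  qed
  have e: "q ^ (2 * n + 2) * q ^ (2 * Suc n) = q ^ (4 * n + 4)"
    unfolding power_add[symmetric] by (rule arg_cong[where f = "\<lambda>k. q ^ k"]) simp
  have "even_sum (q\<^sup>2) (slater1 q) (Suc n) * (1 - q ^ (4 * n + 4)) = odd_sum (q\<^sup>2) (slater3 q) n"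
    unfolding slater3_eq_slater1_slater2 slater2_eq_slater4 slater1_eq_slater4[symmetric] e[symmetric]
    by (simp add: algebra_simps)
  also have "\<dots> = even_sum (q\<^sup>2) (slater1 q) n / (1 + q ^ (2 * n + 1))"
    unfolding slater1_eq_slater3[of n] using nz by (simp del: power_Suc)
  finally have "even_sum (q\<^sup>2) (slater1 q) (Suc n)
      = 1 / (qpoch (- q) (q\<^sup>2) n * qpoch (q ^ 4) (q ^ 4) n) / (1 + q ^ (2 * n + 1)) / (1 - q ^ (4 * n + 4))"
    unfolding Suc using nz by (metis nonzero_mult_div_cancel_right)
  moreover have "1 - (- q) * (q\<^sup>2) ^ n = 1 + q ^ (2 * n + 1)" "1 - q ^ 4 * (q ^ 4) ^ n = 1 - q ^ (4 * n + 4)"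
    by (simp_all add: power_mult power_add)
  ultimately show ?case
    by (simp only: qpoch_Suc) (simp add: mult_ac)
qed (simp add: even_sum_def slater1_def)

lemma norm_slater_le:
  "norm (slater1 q r) \<le> 2" "norm (slater2 q r) \<le> 2" "norm (slater3 q r) \<le> 2" "norm (slater4 q r) \<le> 2"
proof -
  have P: "norm (q ^ k) \<le> 1" for k
    by (rule norm_power_le_1[OF q])
  have bound: "norm (c * q ^ k * (1 + d * q ^ l)) \<le> 2" if "norm c = 1" "norm d = 1" for c d k l
  proof -
    have "norm (1 + d * q ^ l) \<le> 2"
      using norm_triangle_ineq[of 1 "d * q ^ l"] P[of l] that by (simp add: norm_mult)
    then have "norm (q ^ k) * norm (1 + d * q ^ l) \<le> 1 * 2"
      using P[of k] by (intro mult_mono) auto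
    then show ?thesis using that by (simp add: norm_mult)
  qed
  have s: "norm ((-1 :: complex) ^ r) = 1" by (simp add: norm_power)
  have "(-1) ^ r * q ^ (3 * (r choose 2)) * q ^ r * (1 + q ^ r) = (-1) ^ r * q ^ (3 * (r choose 2) + r) * (1 + 1 * q ^ r)"
    by (simp add: power_add)
  then have "norm ((-1) ^ r * q ^ (3 * (r choose 2)) * q ^ r * (1 + q ^ r)) \<le> 2"
    using bound[OF s, of 1] by (simp only: norm_one)
  then show "norm (slater1 q r) \<le> 2"
    by (simp add: slater1_def)
  have "(-1) ^ r * q ^ (3 * (r choose 2)) * (1 + (q ^ r) ^ 3) = (-1) ^ r * q ^ (3 * (r choose 2)) * (1 + 1 * q ^ (r * 3))"
    by (simp add: power_mult)
  then have "norm ((-1) ^ r * q ^ (3 * (r choose 2)) * (1 + (q ^ r) ^ 3)) \<le> 2"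
    using bound[OF s, of 1] by (simp only: norm_one)
  then show "norm (slater2 q r) \<le> 2"
    by (simp add: slater2_def)
  have "slater3 q r = (-1) ^ r * q ^ (3 * (r choose 2) + r * 2) * (1 + (-1) * q ^ Suc (r * 2))"
    by (simp add: slater3_def power_add power_mult)
  then show "norm (slater3 q r) \<le> 2"
    using bound[OF s, of "-1"] by (simp only: norm_minus_cancel norm_one)
  have "slater4 q r = (-1) ^ r * q ^ (3 * (r choose 2) + r) * (1 + (-1) * q ^ (2 + r * 4))"
    by (simp only: slater4_def power_add power_mult) simp
  then show "norm (slater4 q r) \<le> 2"
    using bound[OF s, of "-1"] by (simp only: norm_minus_cancel norm_one)
qed

lemma slater_bailey_pairs:
  defines "F \<equiv> qpoch (q ^ 4) (q ^ 4)"
  shows "bailey_pair 1 (q\<^sup>2) (slater1 q) (\<lambda>k. 1 / (qpoch (- q) (q\<^sup>2) k * F k))"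
    and "bailey_pair 1 (q\<^sup>2) (slater2 q) (\<lambda>k. q ^ (2 * k) / (qpoch (- q) (q\<^sup>2) k * F k))"
    and "bailey_pair (q\<^sup>2) (q\<^sup>2) (\<lambda>r. slater3 q r / (1 - q)) (\<lambda>k. 1 / (qpoch (- (q ^ 3)) (q\<^sup>2) k * F k))"
    and "bailey_pair (q\<^sup>2) (q\<^sup>2) (\<lambda>r. slater4 q r / (1 - q\<^sup>2)) (\<lambda>k. 1 / (qpoch (- q) (q\<^sup>2) k * F k))"
proof -
  have Q: "norm (q\<^sup>2) < 1"
    by (rule norm_power2_less_1)
  have nz: "1 - q \<noteq> 0" "1 - q\<^sup>2 \<noteq> 0"
    using one_minus_power_nonzero[OF q, of 1] one_minus_power_nonzero[OF q, of 2] by simp_all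
  then have nz': "1 + q \<noteq> 0"
    using power2_eq_1_iff[of q] by (auto simp: add_eq_0_iff)
  show "bailey_pair 1 (q\<^sup>2) (slater1 q) (\<lambda>k. 1 / (qpoch (- q) (q\<^sup>2) k * F k))"
    by (rule bailey_pair_1I) (simp add: slater1_sum F_def)
  show "bailey_pair 1 (q\<^sup>2) (slater2 q) (\<lambda>k. q ^ (2 * k) / (qpoch (- q) (q\<^sup>2) k * F k))"
    by (rule bailey_pair_1I)
       (simp add: slater2_eq_slater4 slater1_eq_slater4[symmetric] slater1_sum F_def)
  show "bailey_pair (q\<^sup>2) (q\<^sup>2) (\<lambda>r. slater4 q r / (1 - q\<^sup>2)) (\<lambda>k. 1 / (qpoch (- q) (q\<^sup>2) k * F k))"
  proof (rule bailey_pair_qI[OF Q])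
    fix n
    show "1 / (qpoch (- q) (q\<^sup>2) n * F n) = (1 - q\<^sup>2) * odd_sum (q\<^sup>2) (\<lambda>r. slater4 q r / (1 - q\<^sup>2)) n"
      using nz odd_sum_scale[of "q\<^sup>2" "1 / (1 - q\<^sup>2)" "slater4 q" n]
      by (simp add: slater1_eq_slater4[symmetric] slater1_sum F_def)
  qed
  show "bailey_pair (q\<^sup>2) (q\<^sup>2) (\<lambda>r. slater3 q r / (1 - q)) (\<lambda>k. 1 / (qpoch (- (q ^ 3)) (q\<^sup>2) k * F k))"
  proof (rule bailey_pair_qI[OF Q])
    fix n
    have e: "1 + q ^ (2 * n + 1) = 1 - (- q) * (q\<^sup>2) ^ n"
      by (simp add: power_mult)
    have "norm (- q) < 1" using q by simp
    then have "qpoch (- q) (q\<^sup>2) (Suc n) \<noteq> 0"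
      by (rule qpoch_nonzero[OF _ Q])
    then have "1 + q ^ (2 * n + 1) \<noteq> 0"
      unfolding qpoch_Suc e by simp
    then have "odd_sum (q\<^sup>2) (slater3 q) n = even_sum (q\<^sup>2) (slater1 q) n / (1 + q ^ (2 * n + 1))"
      using slater1_eq_slater3[of n] by simp
    then have "odd_sum (q\<^sup>2) (slater3 q) n = 1 / (qpoch (- q) (q\<^sup>2) (Suc n) * F n)"
      unfolding slater1_sum F_def[symmetric] e qpoch_Suc by (simp add: mult_ac)
    also have "qpoch (- q) (q\<^sup>2) (Suc n) = (1 + q) * qpoch (- (q ^ 3)) (q\<^sup>2) n"
      by (simp add: qpoch_Suc_left power3_eq_cube power2_eq_square mult.assoc)
    finally have *: "odd_sum (q\<^sup>2) (slater3 q) n = 1 / ((1 + q) * qpoch (- (q ^ 3)) (q\<^sup>2) n * F n)" .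
    have "(1 - q\<^sup>2) * (1 / (1 - q) * odd_sum (q\<^sup>2) (slater3 q) n) = (1 + q) * odd_sum (q\<^sup>2) (slater3 q) n"
      using nz by (simp add: power2_eq_square field_simps)
    then show "1 / (qpoch (- (q ^ 3)) (q\<^sup>2) n * F n) = (1 - q\<^sup>2) * odd_sum (q\<^sup>2) (\<lambda>r. slater3 q r / (1 - q)) n"
      using nz' odd_sum_scale[of "q\<^sup>2" "1 / (1 - q)" "slater3 q" n] by (simp add: *)
  qed
qed


section \<open>The four identities\<close>

text \<open>
  By \<open>(-q;q\<^sup>2)_inf (q;q\<^sup>2)_inf = (q\<^sup>2;q^4)_inf\<close> and
  \<open>(q\<^sup>2;q\<^sup>2)_inf = (q\<^sup>2;q^4)_inf (q^4;q^4)_inf\<close>.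
\<close>

lemma quotient_of_products:
  "qpoch_inf (- q) (q\<^sup>2) * z / qpoch_inf (q\<^sup>2) (q\<^sup>2) = z / (qpoch_inf q (q\<^sup>2) * qpoch_inf (q ^ 4) (q ^ 4))"
proof -
  have Q: "norm (q\<^sup>2) < 1"
    by (rule norm_power2_less_1)
  have "qpoch_inf (- q) (q\<^sup>2) * qpoch_inf q (q\<^sup>2) = qpoch_inf (q\<^sup>2) (q ^ 4)"
    using qpoch_inf_mult_neg[OF Q, where a = q] by simp
  moreover have "qpoch_inf (q\<^sup>2) (q\<^sup>2) = qpoch_inf (q\<^sup>2) (q ^ 4) * qpoch_inf (q ^ 4) (q ^ 4)"
  proof -
    have "{..<2::nat} = {0, 1}" by auto
    moreover have "q\<^sup>2 * (q\<^sup>2) ^ 1 = q ^ 4" "(q\<^sup>2)\<^sup>2 = q ^ 4"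
      by (simp_all flip: power_add power_mult)
    ultimately show ?thesis
      using qpoch_inf_multisection[OF Q, where k = 2 and a = "q\<^sup>2"] by simp
  qed
  moreover have "qpoch_inf (q\<^sup>2) (q\<^sup>2) \<noteq> 0" "qpoch_inf q (q\<^sup>2) \<noteq> 0"
    using Q q by (intro qpoch_inf_nonzero; simp)+
  ultimately show ?thesis
    by (auto simp: divide_simps)
qed

lemma power_swap: "(z ^ m) ^ n = (z ^ n) ^ m" for z :: complex
  by (simp only: power_mult[symmetric] mult.commute)

text \<open>
  The exponents \<open>2 r\<^sup>2\<close> (from the sum over \<open>n\<close>) and \<open>r\<^sup>2\<close> (from the weight), possibly with linear terms,
  join those of Slater's sequences.  In the last two cases the weight also contributes
  \<open>1 + q^(2r+1)\<close> to the numerator or denominator; it completes \<open>1 - q^(2r+1)\<close> to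
  \<open>1 - q^(4r+2)\<close>, or reduces the latter to the former.
\<close>

lemma theta_slater:
  "(q\<^sup>2) ^ (r\<^sup>2) * q ^ r * (q\<^sup>2) ^ (r choose 2) * slater1 q r = theta_even (q ^ 4) (q ^ 5) r"
  "(q\<^sup>2) ^ (r\<^sup>2) * q ^ r * (q\<^sup>2) ^ (r choose 2) * slater2 q r = theta_even (q ^ 3) (q ^ 6) r"
  "q ^ (2 * r) * (q\<^sup>2) ^ (r\<^sup>2) * q ^ r * (q\<^sup>2) ^ (r choose 2) * (slater3 q r * (1 + q * (q\<^sup>2) ^ r))
     = theta_odd (q ^ 7) (q\<^sup>2) r"
  "q ^ (2 * r) * (q\<^sup>2) ^ (r\<^sup>2) * q ^ (3 * r) * (q\<^sup>2) ^ (r choose 2) * slater4 q r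
     = (1 + q * (q\<^sup>2) ^ r) * theta_odd (q ^ 8) q r"
proof -
  \<comment> \<open>In terms of \<open>c\<close> and \<open>X\<close> all four claims are polynomial identities.\<close>
  define c X where "c = q ^ (r choose 2)" and "X = q ^ r"
  have c: "(q ^ m) ^ (r choose 2) = c ^ m" "q ^ (m * (r choose 2)) = c ^ m" for m
    unfolding c_def power_mult by (rule power_swap)+
  have X: "(q ^ m) ^ r = X ^ m" "q ^ (m * r) = X ^ m" for m
    unfolding X_def power_mult by (rule power_swap)+
  have s: "(q\<^sup>2) ^ (r\<^sup>2) = c ^ 4 * X\<^sup>2"
    unfolding square_eq_choose_two power_add X by (simp add: c power_mult[symmetric] flip: c_def)
  have p: "q ^ 4 * q ^ 5 = q ^ 9" "q ^ 3 * q ^ 6 = q ^ 9" "q ^ 7 * q\<^sup>2 = q ^ 9" "q ^ 8 * q = q ^ 9"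
    by (simp_all flip: power_add power_Suc2)
  show "(q\<^sup>2) ^ (r\<^sup>2) * q ^ r * (q\<^sup>2) ^ (r choose 2) * slater1 q r = theta_even (q ^ 4) (q ^ 5) r"
  proof (cases "r = 0")
    case False
    have "c ^ 4 * X\<^sup>2 * X * c\<^sup>2 * (d * c ^ 3 * X * (1 + X)) = d * c ^ 9 * (X ^ 4 + X ^ 5)" for d
      by algebra
    then show ?thesis
      using False by (simp only: slater1_def theta_even_def if_False p c X s flip: X_def)
  qed (simp add: slater1_def theta_even_def)
  show "(q\<^sup>2) ^ (r\<^sup>2) * q ^ r * (q\<^sup>2) ^ (r choose 2) * slater2 q r = theta_even (q ^ 3) (q ^ 6) r"
  proof (cases "r = 0")
    case False
    have "c ^ 4 * X\<^sup>2 * X * c\<^sup>2 * (d * c ^ 3 * (1 + X ^ 3)) = d * c ^ 9 * (X ^ 3 + X ^ 6)" for d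
      by algebra
    then show ?thesis
      using False by (simp only: slater2_def theta_even_def if_False p c X s flip: X_def)
  qed (simp add: slater2_def theta_even_def)
  have "X\<^sup>2 * (c ^ 4 * X\<^sup>2) * X * c\<^sup>2 * (d * c ^ 3 * X\<^sup>2 * (1 - q * X\<^sup>2) * (1 + q * X\<^sup>2))
      = d * c ^ 9 * (X ^ 7 - X ^ 9 * (q\<^sup>2 * X\<^sup>2))" for d
    by algebra
  then show "q ^ (2 * r) * (q\<^sup>2) ^ (r\<^sup>2) * q ^ r * (q\<^sup>2) ^ (r choose 2) * (slater3 q r * (1 + q * (q\<^sup>2) ^ r))
     = theta_odd (q ^ 7) (q\<^sup>2) r"
    by (simp only: slater3_def theta_odd_def p c X s power_Suc[of "q\<^sup>2"] flip: X_def)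
  have "X\<^sup>2 * (c ^ 4 * X\<^sup>2) * X ^ 3 * c\<^sup>2 * (d * c ^ 3 * X * (1 - q\<^sup>2 * X ^ 4))
      = (1 + q * X\<^sup>2) * (d * c ^ 9 * (X ^ 8 - X ^ 9 * (q * X)))" for d
    by algebra
  then show "q ^ (2 * r) * (q\<^sup>2) ^ (r\<^sup>2) * q ^ (3 * r) * (q\<^sup>2) ^ (r choose 2) * slater4 q r
     = (1 + q * (q\<^sup>2) ^ r) * theta_odd (q ^ 8) q r"
    by (simp only: slater4_def theta_odd_def p c X s power_Suc[of q] flip: X_def)
qed

lemma norm_power_less_1: "n > 0 \<Longrightarrow> norm (q ^ n) < 1"
  using q by (simp add: norm_power power_less_one_iff)

lemma mod9_identity_4_5:
  "((\<lambda>(i, j, k). q ^ (i\<^sup>2 + 2 * j\<^sup>2 + 3 * k\<^sup>2 + 2 * i * j + 2 * i * k + 4 * j * k)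
        / (qpoch (q\<^sup>2) (q\<^sup>2) i * qpoch (q\<^sup>2) (q\<^sup>2) j * qpoch (q ^ 4) (q ^ 4) k))
     has_sum (qpoch_inf_list [q ^ 4, q ^ 5, q ^ 9] (q ^ 9) / (qpoch_inf q (q\<^sup>2) * qpoch_inf (q ^ 4) (q ^ 4))))
   (UNIV :: (nat \<times> nat \<times> nat) set)"
proof -
  let ?J = "qpoch_inf (q ^ 4) (q ^ 9) * qpoch_inf (q ^ 5) (q ^ 9) * qpoch_inf (q ^ 9) (q ^ 9)"
  have "q ^ 4 * q ^ 5 = q ^ 9"
    by (simp flip: power_add)
  then have J: "theta_even (q ^ 4) (q ^ 5) sums ?J"
    using jacobi_triple_product_even[of "q ^ 4" "q ^ 5"] norm_power_less_1[of 4] norm_power_less_1[of 5]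
    by simp
  have split: "qpoch (- q) (q\<^sup>2) r * qpoch_inf (- q * (q\<^sup>2) ^ r) (q\<^sup>2) = qpoch_inf (- q) (q\<^sup>2)" for r
    by (rule qpoch_inf_split[OF norm_power2_less_1, symmetric])
  have "q ^ (2 * 0 * r) * (q\<^sup>2) ^ (r\<^sup>2) * q ^ (Suc 0 * r) * (q\<^sup>2) ^ (r choose 2)
      * (qpoch (- (q ^ 1)) (q\<^sup>2) r * qpoch_inf (- (q ^ Suc 0) * (q\<^sup>2) ^ r) (q\<^sup>2)) * slater1 q r
      = qpoch_inf (- q) (q\<^sup>2) * theta_even (q ^ 4) (q ^ 5) r" for r
    unfolding theta_slater(1)[symmetric] split[symmetric, of r] by (simp add: mult_ac)
  then have T: "(\<lambda>r. q ^ (2 * 0 * r) * (q\<^sup>2) ^ (r\<^sup>2) * q ^ (Suc 0 * r) * (q\<^sup>2) ^ (r choose 2)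
      * (qpoch (- (q ^ 1)) (q\<^sup>2) r * qpoch_inf (- (q ^ Suc 0) * (q\<^sup>2) ^ r) (q\<^sup>2)) * slater1 q r) sums (qpoch_inf (- q) (q\<^sup>2) * ?J)"
    by (simp only: sums_mult[OF J])
  from triple_sum_of_bailey_pair[OF q _ _ _ norm_slater_le(1) T, where t = 0]
  show ?thesis
    using slater_bailey_pairs(1) by (simp add: quotient_of_products qpoch_inf_list_def mult.assoc flip: power2_eq_square)
qed

text \<open>
  The theta product \<open>(q^3, q^6, q^9; q^9)_inf\<close> collapses to \<open>(q^3; q^3)_inf\<close>.
\<close>

lemma mod9_identity_3_6:
  "((\<lambda>(i, j, k). q ^ (i\<^sup>2 + 2 * j\<^sup>2 + 3 * k\<^sup>2 + 2 * i * j + 2 * i * k + 4 * j * k + 2 * k)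
        / (qpoch (q\<^sup>2) (q\<^sup>2) i * qpoch (q\<^sup>2) (q\<^sup>2) j * qpoch (q ^ 4) (q ^ 4) k))
     has_sum (qpoch_inf (q ^ 3) (q ^ 3) / (qpoch_inf q (q\<^sup>2) * qpoch_inf (q ^ 4) (q ^ 4))))
   (UNIV :: (nat \<times> nat \<times> nat) set)"
proof -
  have "q ^ 3 * q ^ 6 = q ^ 9"
    by (simp flip: power_add)
  moreover have "qpoch_inf (q ^ 3) (q ^ 3)
      = qpoch_inf (q ^ 3) (q ^ 9) * qpoch_inf (q ^ 6) (q ^ 9) * qpoch_inf (q ^ 9) (q ^ 9)"
  proof -
    have "{..<3::nat} = {0, 1, 2}" by auto
    moreover have "q ^ 3 * (q ^ 3) ^ 1 = q ^ 6" "q ^ 3 * (q ^ 3) ^ 2 = q ^ 9" "(q ^ 3) ^ 3 = q ^ 9"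
      by (simp_all flip: power_add power_mult)
    ultimately show ?thesis
      using qpoch_inf_multisection[OF norm_power_less_1[of 3], where k = 3 and a = "q ^ 3"] by simp
  qed
  ultimately have J: "theta_even (q ^ 3) (q ^ 6) sums qpoch_inf (q ^ 3) (q ^ 3)"
    using jacobi_triple_product_even[of "q ^ 3" "q ^ 6"] norm_power_less_1[of 3] norm_power_less_1[of 6]
    by simp
  have split: "qpoch (- q) (q\<^sup>2) r * qpoch_inf (- q * (q\<^sup>2) ^ r) (q\<^sup>2) = qpoch_inf (- q) (q\<^sup>2)" for r
    by (rule qpoch_inf_split[OF norm_power2_less_1, symmetric])
  have "q ^ (2 * 0 * r) * (q\<^sup>2) ^ (r\<^sup>2) * q ^ (Suc 0 * r) * (q\<^sup>2) ^ (r choose 2)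
      * (qpoch (- (q ^ 1)) (q\<^sup>2) r * qpoch_inf (- (q ^ Suc 0) * (q\<^sup>2) ^ r) (q\<^sup>2)) * slater2 q r
      = qpoch_inf (- q) (q\<^sup>2) * theta_even (q ^ 3) (q ^ 6) r" for r
    unfolding theta_slater(2)[symmetric] split[symmetric, of r] by (simp add: mult_ac)
  then have T: "(\<lambda>r. q ^ (2 * 0 * r) * (q\<^sup>2) ^ (r\<^sup>2) * q ^ (Suc 0 * r) * (q\<^sup>2) ^ (r choose 2)
      * (qpoch (- (q ^ 1)) (q\<^sup>2) r * qpoch_inf (- (q ^ Suc 0) * (q\<^sup>2) ^ r) (q\<^sup>2)) * slater2 q r) sums (qpoch_inf (- q) (q\<^sup>2) * qpoch_inf (q ^ 3) (q ^ 3))"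
    by (simp only: sums_mult[OF J])
  from triple_sum_of_bailey_pair[OF q _ _ _ norm_slater_le(2) T, where t = 2]
  show ?thesis
    using slater_bailey_pairs(2) by (simp add: quotient_of_products add_ac flip: power2_eq_square)
qed

lemma qpoch_inf_square_eq:
  "qpoch_inf (q\<^sup>2) (q\<^sup>2) = (1 - q\<^sup>2) * qpoch_inf (q ^ 4) (q\<^sup>2)"
  using qpoch_inf_split[OF norm_power2_less_1, of "q\<^sup>2" 1] by (simp add: qpoch_Suc flip: power_add)

text \<open>
  For \<open>a = q\<^sup>2\<close> the parameters \<open>-x\<close> and \<open>-\<rho>\<close> are \<open>q\<close> and \<open>q^3\<close> in one of the two orders: this order
  belongs to \<open>slater3\<close>, the other one to \<open>slater4\<close>.
\<close>

lemma mod9_identity_2_7: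
  "((\<lambda>(i, j, k). q ^ (i\<^sup>2 + 2 * j\<^sup>2 + 3 * k\<^sup>2 + 2 * i * j + 2 * i * k + 4 * j * k + 2 * j + 2 * k)
        / (qpoch (q\<^sup>2) (q\<^sup>2) i * qpoch (q\<^sup>2) (q\<^sup>2) j * qpoch (q ^ 4) (q ^ 4) k))
     has_sum (qpoch_inf_list [q ^ 2, q ^ 7, q ^ 9] (q ^ 9) / (qpoch_inf q (q\<^sup>2) * qpoch_inf (q ^ 4) (q ^ 4))))
   (UNIV :: (nat \<times> nat \<times> nat) set)"
proof -
  let ?J = "qpoch_inf (q ^ 7) (q ^ 9) * qpoch_inf (q\<^sup>2) (q ^ 9) * qpoch_inf (q ^ 9) (q ^ 9)"
  let ?c = "qpoch_inf (- q) (q\<^sup>2) / (1 - q\<^sup>2)"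
  have nz: "1 - q \<noteq> 0" "1 + q \<noteq> 0" "1 - q\<^sup>2 = (1 + q) * (1 - q)"
    using mult_power_neq_1[of q q 0] mult_power_neq_1[of "-q" q 0] q
    by (auto simp: algebra_simps power2_eq_square add_eq_0_iff)
  have "q ^ 7 * q\<^sup>2 = q ^ 9"
    by (simp flip: power_add)
  then have J: "theta_odd (q ^ 7) (q\<^sup>2) sums ?J"
    using jacobi_triple_product_odd[of "q ^ 7" "q\<^sup>2"] norm_power_less_1[of 7] norm_power_less_1[of 2]
    by simp
  have split: "(1 + q) * (qpoch (- (q ^ 3)) (q\<^sup>2) r * qpoch_inf (- q * (q\<^sup>2) ^ r) (q\<^sup>2))
      = (1 + q * (q\<^sup>2) ^ r) * qpoch_inf (- q) (q\<^sup>2)" for r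
  proof -
    have "(1 + q) * qpoch (- (q ^ 3)) (q\<^sup>2) r = qpoch (- q) (q\<^sup>2) (Suc r)"
      by (simp add: qpoch_Suc_left power3_eq_cube power2_eq_square mult.assoc)
    also have "\<dots> = qpoch (- q) (q\<^sup>2) r * (1 + q * (q\<^sup>2) ^ r)"
      by (simp add: qpoch_Suc)
    finally show ?thesis
      using qpoch_inf_split[OF norm_power2_less_1, of "- q" r] by (simp add: mult_ac)
  qed
  have "q ^ (2 * 1 * r) * (q\<^sup>2) ^ (r\<^sup>2) * q ^ (Suc 0 * r) * (q\<^sup>2) ^ (r choose 2)
      * (qpoch (- (q ^ 3)) (q\<^sup>2) r * qpoch_inf (- (q ^ Suc 0) * (q\<^sup>2) ^ r) (q\<^sup>2)) * (slater3 q r / (1 - q))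
      = ?c * theta_odd (q ^ 7) (q\<^sup>2) r" for r
  proof -
    have "qpoch (- (q ^ 3)) (q\<^sup>2) r * qpoch_inf (- q * (q\<^sup>2) ^ r) (q\<^sup>2)
        = (1 + q * (q\<^sup>2) ^ r) * qpoch_inf (- q) (q\<^sup>2) / (1 + q)"
      using split[of r] nz by (simp add: field_simps)
    then show ?thesis
      unfolding theta_slater(3)[symmetric] nz(3) by simp
  qed
  then have T: "(\<lambda>r. q ^ (2 * 1 * r) * (q\<^sup>2) ^ (r\<^sup>2) * q ^ (Suc 0 * r) * (q\<^sup>2) ^ (r choose 2)
      * (qpoch (- (q ^ 3)) (q\<^sup>2) r * qpoch_inf (- (q ^ Suc 0) * (q\<^sup>2) ^ r) (q\<^sup>2)) * (slater3 q r / (1 - q))) sums (?c * ?J)"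
    by (simp only: sums_mult[OF J])
  have K: "norm (slater3 q r / (1 - q)) \<le> 2 / norm (1 - q)" for r
    unfolding norm_divide by (intro divide_right_mono norm_slater_le) auto
  from triple_sum_of_bailey_pair[OF q _ _ _ K T, where t = 0]
  show ?thesis
    using slater_bailey_pairs(3) quotient_of_products[of ?J]
    by (simp add: qpoch_inf_square_eq qpoch_inf_list_def mult_ac)
qed

lemma mod9_identity_1_8:
  "((\<lambda>(i, j, k). q ^ (i\<^sup>2 + 2 * j\<^sup>2 + 3 * k\<^sup>2 + 2 * i * j + 2 * i * k + 4 * j * k + 2 * i + 2 * j + 4 * k)
        / (qpoch (q\<^sup>2) (q\<^sup>2) i * qpoch (q\<^sup>2) (q\<^sup>2) j * qpoch (q ^ 4) (q ^ 4) k))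
     has_sum (qpoch_inf_list [q, q ^ 8, q ^ 9] (q ^ 9) / (qpoch_inf q (q\<^sup>2) * qpoch_inf (q ^ 4) (q ^ 4))))
   (UNIV :: (nat \<times> nat \<times> nat) set)"
proof -
  let ?J = "qpoch_inf (q ^ 8) (q ^ 9) * qpoch_inf q (q ^ 9) * qpoch_inf (q ^ 9) (q ^ 9)"
  let ?c = "qpoch_inf (- q) (q\<^sup>2) / (1 - q\<^sup>2)"
  have "q ^ 8 * q = q ^ 9"
    by (simp flip: power_Suc2)
  then have J: "theta_odd (q ^ 8) q sums ?J"
    using jacobi_triple_product_odd[of "q ^ 8" q] norm_power_less_1[of 8] q
    by simp
  have "q ^ (2 * 1 * r) * (q\<^sup>2) ^ (r\<^sup>2) * q ^ (Suc 2 * r) * (q\<^sup>2) ^ (r choose 2)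
      * (qpoch (- (q ^ 1)) (q\<^sup>2) r * qpoch_inf (- (q ^ Suc 2) * (q\<^sup>2) ^ r) (q\<^sup>2)) * (slater4 q r / (1 - q\<^sup>2))
      = ?c * theta_odd (q ^ 8) q r" for r
  proof -
    have nz: "1 + q * (q\<^sup>2) ^ r \<noteq> 0"
      using mult_power_neq_1[of "- q" "q\<^sup>2" r] q norm_power2_less_1 by (auto simp: add_eq_0_iff)
    have "qpoch_inf (- q) (q\<^sup>2) = (1 + q * (q\<^sup>2) ^ r) * (qpoch (- q) (q\<^sup>2) r * qpoch_inf (- (q ^ 3) * (q\<^sup>2) ^ r) (q\<^sup>2))"
      using qpoch_inf_split[OF norm_power2_less_1, of "- q" "Suc r"]
      by (simp add: qpoch_Suc power3_eq_cube power2_eq_square mult_ac)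
    moreover have "Suc 2 = 3" by simp
    \<comment> \<open>The factor \<open>1 + q Q^r\<close> of \<open>(-q;Q)_inf\<close> occurs neither in \<open>(-q;Q)_r\<close> nor in \<open>(-q^3 Q^r;Q)_inf\<close>;
      it cancels against one factor of \<open>1 - q^(4r+2)\<close>.\<close>
    ultimately have "(1 + q * (q\<^sup>2) ^ r) * (q ^ (2 * 1 * r) * (q\<^sup>2) ^ (r\<^sup>2) * q ^ (Suc 2 * r) * (q\<^sup>2) ^ (r choose 2)
      * (qpoch (- (q ^ 1)) (q\<^sup>2) r * qpoch_inf (- (q ^ Suc 2) * (q\<^sup>2) ^ r) (q\<^sup>2)) * (slater4 q r / (1 - q\<^sup>2)))
      = qpoch_inf (- q) (q\<^sup>2) / (1 - q\<^sup>2) * (q ^ (2 * r) * (q\<^sup>2) ^ (r\<^sup>2) * q ^ (3 * r) * (q\<^sup>2) ^ (r choose 2) * slater4 q r)"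
      by (simp add: mult_ac)
    then show ?thesis
      unfolding theta_slater(4) using nz by (simp add: mult_ac)
  qed
  then have T: "(\<lambda>r. q ^ (2 * 1 * r) * (q\<^sup>2) ^ (r\<^sup>2) * q ^ (Suc 2 * r) * (q\<^sup>2) ^ (r choose 2)
      * (qpoch (- (q ^ 1)) (q\<^sup>2) r * qpoch_inf (- (q ^ Suc 2) * (q\<^sup>2) ^ r) (q\<^sup>2)) * (slater4 q r / (1 - q\<^sup>2))) sums (?c * ?J)"
    by (simp only: sums_mult[OF J])
  have K: "norm (slater4 q r / (1 - q\<^sup>2)) \<le> 2 / norm (1 - q\<^sup>2)" for r
    unfolding norm_divide by (intro divide_right_mono norm_slater_le) auto
  from triple_sum_of_bailey_pair[OF q _ _ _ K T, where t = 0]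
  show ?thesis
    using slater_bailey_pairs(4) quotient_of_products[of ?J]
    by (simp add: qpoch_inf_square_eq qpoch_inf_list_def mult_ac)
qed

end

theorem theorem3p16:
  fixes q :: complex
  assumes "norm q < 1"
  shows "((\<lambda>(i, j, k).
             q ^ (i\<^sup>2 + 2 * j\<^sup>2 + 3 * k\<^sup>2 + 2 * i * j + 2 * i * k + 4 * j * k)
               / (qpoch (q\<^sup>2) (q\<^sup>2) i * qpoch (q\<^sup>2) (q\<^sup>2) j * qpoch (q ^ 4) (q ^ 4) k))
           has_sum
             (qpoch_inf_list [q ^ 4, q ^ 5, q ^ 9] (q ^ 9) / (qpoch_inf q (q\<^sup>2) * qpoch_inf (q ^ 4) (q ^ 4))))
           (UNIV :: (nat \<times> nat \<times> nat) set) \<and>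
         ((\<lambda>(i, j, k).
             q ^ (i\<^sup>2 + 2 * j\<^sup>2 + 3 * k\<^sup>2 + 2 * i * j + 2 * i * k + 4 * j * k + 2 * k)
               / (qpoch (q\<^sup>2) (q\<^sup>2) i * qpoch (q\<^sup>2) (q\<^sup>2) j * qpoch (q ^ 4) (q ^ 4) k))
           has_sum
             (qpoch_inf (q ^ 3) (q ^ 3) / (qpoch_inf q (q\<^sup>2) * qpoch_inf (q ^ 4) (q ^ 4))))
           (UNIV :: (nat \<times> nat \<times> nat) set) \<and>
         ((\<lambda>(i, j, k).
             q ^ (i\<^sup>2 + 2 * j\<^sup>2 + 3 * k\<^sup>2 + 2 * i * j + 2 * i * k + 4 * j * k + 2 * j + 2 * k)
               / (qpoch (q\<^sup>2) (q\<^sup>2) i * qpoch (q\<^sup>2) (q\<^sup>2) j * qpoch (q ^ 4) (q ^ 4) k))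
           has_sum
             (qpoch_inf_list [q ^ 2, q ^ 7, q ^ 9] (q ^ 9) / (qpoch_inf q (q\<^sup>2) * qpoch_inf (q ^ 4) (q ^ 4))))
           (UNIV :: (nat \<times> nat \<times> nat) set) \<and>
         ((\<lambda>(i, j, k).
             q ^ (i\<^sup>2 + 2 * j\<^sup>2 + 3 * k\<^sup>2 + 2 * i * j + 2 * i * k + 4 * j * k + 2 * i + 2 * j + 4 * k)
               / (qpoch (q\<^sup>2) (q\<^sup>2) i * qpoch (q\<^sup>2) (q\<^sup>2) j * qpoch (q ^ 4) (q ^ 4) k))
           has_sum
             (qpoch_inf_list [q, q ^ 8, q ^ 9] (q ^ 9) / (qpoch_inf q (q\<^sup>2) * qpoch_inf (q ^ 4) (q ^ 4))))
           (UNIV :: (nat \<times> nat \<times> nat) set)"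
  using mod9_identity_4_5[OF assms] mod9_identity_3_6[OF assms]
    mod9_identity_2_7[OF assms] mod9_identity_1_8[OF assms]
  by blast

end
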